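(* Let $2<p<6$, let $\mathcal G$ be a metric graph with $n\ge 1$ infinite edges, and let $w\ge 0$ be a continuous, not identically vanishing function on $\mathcal G$ supported on the compact core $\mathcal K$ of $\mathcal G$. Then, if $\mu>0$ is small enough (that is, there exists $\mu_\star>0$ such that for every $0<\mu<\mu_\star$), there exists a Ground State for $E(\cdot,\mathcal G)$ at mass $\mu$.
   Context: Metric graph: $\mathcal G$ is a connected metric graph with finitely many vertices and edges (multiple edges and self-loops allowed). Each edge $e$ is identified with an interval $I_e=[0,\ell_e]$ with $0<\ell_e<\infty$ (bounded edge, both endpoints attached to vertices), or with $I_e=[0,\infty)$ (infinite edge, or halfline, with its origin attached to a vertex). The compact core $\mathcal K$ is the compact subgraph made of all bounded edges and all vertices (the complement of the open halflines). A function $u:\mathcal G\to\mathbb C$ is a family $(u_e)_e$ with $u_e:I_e\to\mathbb C$; $u'=(u_e')_e$ and $\int_{\mathcal G}u\,dx=\sum_e\int_{I_e}u_e\,dx$; $L^p(\mathcal G)$ is defined accordingly. $H^1(\mathcal G)$ is the space of functions $u$ on $\mathcal G$, continuous on $\mathcal G$ (in particular at vertices), with $u_e\in H^1(I_e)$ for every $e$, and norm $\|u\|_{H^1(\mathcal G)}^2=\sum_e\|u_e\|^2_{H^1(I_e)}$. For $\mu>0$, $H^1_\mu(\mathcal G)=\{u\in H^1(\mathcal G):\|u\|^2_{L^2(\mathcal G)}=\mu\}$. Energy: $$E(u,\mathcal G)=\frac12\int_{\mathcal G}|u'|^2dx-\frac1p\int_{\mathcal G}|u|^pdx-\frac12\int_{\mathcal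 K}w|u|^2dx.$$ A Ground State for $E(\cdot,\mathcal G)$ at mass $\mu$ is a $u\in H^1_\mu(\mathcal G)$ with $E(u,\mathcal G)=\inf_{v\in H^1_\mu(\mathcal G)}E(v,\mathcal G)$. *)

theory Defs
  imports "HOL-Analysis.Analysis"
begin

text \<open>
  A metric graph is a finite multigraph, self-loops allowed, whose edges carry lengths in
  the extended reals: an edge of finite length is a bounded edge, an edge of length
  \<open>\<infinity>\<close> is a halfline. The orientation \<open>origin\<close>, \<open>terminus\<close>
  fixes the coordinate on a bounded edge; on a halfline only \<open>origin\<close> has a meaning.
\<close>

record ('v, 'e) pre_metric_graph =
  verts :: "'v set"
  edges :: "'e set"
  len :: "'e \<Rightarrow> ereal"
  origin :: "'e \<Rightarrow> 'v"
  terminus :: "'e \<Rightarrow> 'v"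

definition bounded_edges :: "('v, 'e) pre_metric_graph \<Rightarrow> 'e set" where
  "bounded_edges G = {e \<in> edges G. len G e < \<infinity>}"

definition halflines :: "('v, 'e) pre_metric_graph \<Rightarrow> 'e set" where
  "halflines G = {e \<in> edges G. len G e = \<infinity>}"

definition edge_interval :: "('v, 'e) pre_metric_graph \<Rightarrow> 'e \<Rightarrow> real set" where
  "edge_interval G e = {x. 0 \<le> x \<and> ereal x \<le> len G e}"

definition adjacency :: "('v, 'e) pre_metric_graph \<Rightarrow> ('v \<times> 'v) set" where
  "adjacency G = (\<lambda>e. (origin G e, terminus G e)) ` bounded_edges G"

text \<open>
  A halfline meets a single vertex, so the graph is connected iff any two vertices
  are joined by a path of bounded edges, traversed in either direction.
\<close>

locale metric_graph =
  fixes G :: "('v, 'e) pre_metric_graph"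
  assumes finite_verts: "finite (verts G)"
    and verts_nonempty: "verts G \<noteq> {}"
    and finite_edges: "finite (edges G)"
    and len_pos: "e \<in> edges G \<Longrightarrow> 0 < len G e"
    and origin_in_verts: "e \<in> edges G \<Longrightarrow> origin G e \<in> verts G"
    and terminus_in_verts: "e \<in> bounded_edges G \<Longrightarrow> terminus G e \<in> verts G"
    and connected: "a \<in> verts G \<Longrightarrow> b \<in> verts G \<Longrightarrow>
      (a, b) \<in> (adjacency G \<union> (adjacency G)\<inverse>)\<^sup>*"

text \<open>
  A function on \<open>G\<close> is a family \<open>u\<close> indexed by the edges; only the values
  \<open>u e x\<close> with \<open>e \<in> edges G\<close> and \<open>x \<in> edge_interval G e\<close>
  matter. Continuity at the vertices means that all edge ends attached to a vertex
  \<open>a\<close> share one value \<open>c a\<close>.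
\<close>

definition continuous_on_graph ::
    "('v, 'e) pre_metric_graph \<Rightarrow> ('e \<Rightarrow> real \<Rightarrow> 'a::topological_space) \<Rightarrow> bool" where
  "continuous_on_graph G u \<longleftrightarrow>
     (\<forall>e\<in>edges G. continuous_on (edge_interval G e) (u e)) \<and>
     (\<exists>c :: 'v \<Rightarrow> 'a.
        (\<forall>e\<in>edges G. u e 0 = c (origin G e)) \<and>
        (\<forall>e\<in>bounded_edges G. u e (real_of_ereal (len G e)) = c (terminus G e)))"

text \<open>
  The core consists of the bounded edges and the vertices and is closed, so the support
  lies in it iff the function vanishes on the open halflines.
\<close>

definition supported_on_core ::
    "('v, 'e) pre_metric_graph \<Rightarrow> ('e \<Rightarrow> real \<Rightarrow> 'a::zero) \<Rightarrow> bool" where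
  "supported_on_core G w \<longleftrightarrow> (\<forall>e\<in>halflines G. \<forall>x>0. w e x = 0)"

definition L2_on :: "real set \<Rightarrow> (real \<Rightarrow> complex) \<Rightarrow> bool" where
  "L2_on I f \<longleftrightarrow>
     set_borel_measurable lborel I f \<and> set_integrable lborel I (\<lambda>x. (cmod (f x))\<^sup>2)"

definition test_function :: "real set \<Rightarrow> (real \<Rightarrow> real) \<Rightarrow> bool" where
  "test_function I \<phi> \<longleftrightarrow>
     \<phi> C1_differentiable_on UNIV \<and>
     compact (closure {x. \<phi> x \<noteq> 0}) \<and> closure {x. \<phi> x \<noteq> 0} \<subseteq> interior I"

definition has_weak_derivative_on ::
    "real set \<Rightarrow> (real \<Rightarrow> complex) \<Rightarrow> (real \<Rightarrow> complex) \<Rightarrow> bool" where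
  "has_weak_derivative_on I f g \<longleftrightarrow>
     (\<forall>\<phi>. test_function I \<phi> \<longrightarrow>
        (LINT x:I|lborel. deriv \<phi> x *\<^sub>R f x) = - (LINT x:I|lborel. \<phi> x *\<^sub>R g x))"

definition H1_on :: "real set \<Rightarrow> (real \<Rightarrow> complex) \<Rightarrow> bool" where
  "H1_on I f \<longleftrightarrow> L2_on I f \<and> (\<exists>g. L2_on I g \<and> has_weak_derivative_on I f g)"

text \<open>For \<open>f\<close> in \<open>H\<^sup>1(I)\<close> the choice is unique up to null sets of \<open>I\<close>.\<close>

definition weak_deriv :: "real set \<Rightarrow> (real \<Rightarrow> complex) \<Rightarrow> real \<Rightarrow> complex" where
  "weak_deriv I f = (SOME g. L2_on I g \<and> has_weak_derivative_on I f g)"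

definition H1_graph :: "('v, 'e) pre_metric_graph \<Rightarrow> ('e \<Rightarrow> real \<Rightarrow> complex) set" where
  "H1_graph G =
     {u. continuous_on_graph G u \<and> (\<forall>e\<in>edges G. H1_on (edge_interval G e) (u e))}"

definition H1_mass :: "('v, 'e) pre_metric_graph \<Rightarrow> real \<Rightarrow> ('e \<Rightarrow> real \<Rightarrow> complex) set" where
  "H1_mass G \<mu> =
     {u \<in> H1_graph G.
        (\<Sum>e\<in>edges G. LINT x:edge_interval G e|lborel. (cmod (u e x))\<^sup>2) = \<mu>}"

definition energy ::
    "('v, 'e) pre_metric_graph \<Rightarrow> real \<Rightarrow> ('e \<Rightarrow> real \<Rightarrow> real) \<Rightarrow> ('e \<Rightarrow> real \<Rightarrow> complex) \<Rightarrow> real"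
  where
  "energy G p w u =
     1 / 2 * (\<Sum>e\<in>edges G. LINT x:edge_interval G e|lborel.
                (cmod (weak_deriv (edge_interval G e) (u e) x))\<^sup>2)
     - 1 / p * (\<Sum>e\<in>edges G. LINT x:edge_interval G e|lborel. cmod (u e x) powr p)
     - 1 / 2 * (\<Sum>e\<in>bounded_edges G. LINT x:edge_interval G e|lborel.
                w e x * (cmod (u e x))\<^sup>2)"

text \<open>The infimum is taken in \<open>ereal\<close>, where it is meaningful without a lower bound.\<close>

definition ground_state ::
    "('v, 'e) pre_metric_graph \<Rightarrow> real \<Rightarrow> ('e \<Rightarrow> real \<Rightarrow> real) \<Rightarrow> real \<Rightarrow>
     ('e \<Rightarrow> real \<Rightarrow> complex) \<Rightarrow> bool"
  where
  "ground_state G p w \<mu> u \<longleftrightarrow>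
     u \<in> H1_mass G \<mu> \<and>
     ereal (energy G p w u) = (INF v\<in>H1_mass G \<mu>. ereal (energy G p w v))"

end

theory Submission
  imports Defs "HOL-Complex_Analysis.Great_Picard"
begin

text \<open>
  Write \<open>m\<close> for the infimum of the energy at mass \<open>\<mu>\<close>. A minimizing sequence can fail to
  converge only because mass escapes along the halflines. The proof compares what escaped mass
  costs with what mass gains on the core.

  The gain is linear in \<open>\<mu>\<close>: a function equal to \<open>1\<close> on the core and decaying slowly on the
  halflines has almost no kinetic energy, while \<open>w\<close> gives it a fixed negative potential energy.
  Scaling it to mass \<open>\<mu>\<close> yields \<open>m \<le> - c \<mu>\<close> with \<open>c > 0\<close> independent of \<open>\<mu>\<close>
  (\<open>negative_level\<close>).

  The cost is controlled by smallness. For small \<open>\<mu>\<close> every function of nonpositive energy has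
  kinetic energy at most \<open>1\<close> and is uniformly small; this is where \<open>p < 6\<close> enters
  (\<open>small_mass_bounds\<close>). If \<open>\<bar>u\<bar> \<le> \<delta>\<close> for a suitable \<open>\<delta>\<close>, then
  \<open>c/2 \<bar>u\<bar>\<^sup>2 - 1/p \<bar>u\<bar>\<^sup>p \<ge> 0\<close> pointwise, so that Fatou's lemma applies to this expression on
  every edge, unbounded ones included. Hence \<open>E(u) + c/2 \<parallel>u\<parallel>\<^sup>2\<close>, unlike \<open>E\<close> itself, is lower
  semicontinuous along the minimizing sequence, and the limit \<open>v\<close> satisfies
  \<open>E(v) \<le> m + c/2 (\<mu> - \<parallel>v\<parallel>\<^sup>2)\<close> with \<open>\<parallel>v\<parallel>\<^sup>2 \<le> \<mu>\<close> (\<open>compactness\<close>).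

  No mass is lost. If \<open>a = \<parallel>v\<parallel>\<^sup>2\<close> were in \<open>(0, \<mu>)\<close>, stretching \<open>v\<close> to mass \<open>\<mu>\<close> would
  multiply its energy by at least \<open>\<mu>/a\<close> in the negative direction, since the power term grows
  faster than quadratically. So \<open>m \<le> (\<mu>/a) E(v)\<close>, and with the previous inequality
  \<open>- m \<le> c/2 \<mu>\<close>, which contradicts \<open>m \<le> - c \<mu>\<close>; for \<open>a = 0\<close> the energy of \<open>v\<close> is
  nonnegative and the same contradiction arises. Thus \<open>a = \<mu>\<close> and \<open>E(v) \<le> m\<close>
  (\<open>ground_state_exists\<close>).

  Two facts on weak derivatives support this. A continuous function is the integral of its weak
  derivative (\<open>weak_derivative_FTC\<close>), which gives sup bounds, equicontinuity and uniqueness of the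
  weak derivative. The kinetic energy is lower semicontinuous under bounded pointwise convergence
  (\<open>weak_derivative_lower_semicontinuous\<close>), proved by a relaxation argument instead of weak
  compactness in \<open>L\<^sup>2\<close>.
\<close>

section \<open>Square-integrable functions\<close>

text \<open>
  Fatou's lemma with an upper bound for the integrals that converges along the sequence; this form
  yields integrability of the limit as well.
\<close>

lemma fatou_bound:
  fixes h :: "nat \<Rightarrow> 'a \<Rightarrow> real"
  assumes int: "\<And>n. integrable M (h n)"
    and nonneg: "\<And>n. AE x in M. 0 \<le> h n x"
    and lim: "AE x in M. (\<lambda>n. h n x) \<longlonglongrightarrow> H x"
    and [measurable]: "H \<in> borel_measurable M"
    and bound: "\<And>n. (\<integral>x. h n x \<partial>M) \<le> b n" and b: "b \<longlonglongrightarrow> \<beta>"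
  shows "integrable M H \<and> (\<integral>x. H x \<partial>M) \<le> \<beta>"
proof -
  have [measurable]: "h n \<in> borel_measurable M" for n
    using int by auto
  have nonneg': "AE x in M. \<forall>n. 0 \<le> h n x"
    using nonneg by (simp add: AE_all_countable)
  have H0: "AE x in M. 0 \<le> H x"
    using nonneg' lim by eventually_elim (auto intro: LIMSEQ_le_const)
  have b0: "0 \<le> b n" for n
    using bound[of n] integral_nonneg_AE[OF nonneg[of n]] by linarith
  have "(\<integral>\<^sup>+x. ennreal (H x) \<partial>M) = (\<integral>\<^sup>+x. liminf (\<lambda>n. ennreal (h n x)) \<partial>M)"
  proof (rule nn_integral_cong_AE, use lim in eventually_elim)
    case (elim x)
    then have "(\<lambda>n. ennreal (h n x)) \<longlonglongrightarrow> ennreal (H x)"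
      by (rule tendsto_ennrealI)
    then show ?case by (simp add: lim_imp_Liminf)
  qed
  also have "\<dots> \<le> liminf (\<lambda>n. \<integral>\<^sup>+x. ennreal (h n x) \<partial>M)"
    by (rule nn_integral_liminf) simp
  also have "\<dots> = liminf (\<lambda>n. ennreal (\<integral>x. h n x \<partial>M))"
    using nn_integral_eq_integral[OF int nonneg] by simp
  also have "\<dots> \<le> liminf (\<lambda>n. ennreal (b n))"
    by (intro Liminf_mono always_eventually) (simp add: bound ennreal_leI)
  also have "\<dots> = ennreal \<beta>"
    using tendsto_ennrealI[OF b] by (simp add: lim_imp_Liminf)
  finally have le: "(\<integral>\<^sup>+x. ennreal (H x) \<partial>M) \<le> ennreal \<beta>" .
  have iH: "integrable M H"
    by (rule integrableI_nonneg) (use le H0 in \<open>auto simp: less_top[symmetric] top_unique\<close>)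
  have "0 \<le> \<beta>" using b b0 by (auto intro: LIMSEQ_le_const)
  then have "(\<integral>x. H x \<partial>M) \<le> \<beta>"
    using le nn_integral_eq_integral[OF iH H0] by simp
  with iH show ?thesis by blast
qed

lemma cmod_add_sq_le: "(cmod (a + b))\<^sup>2 \<le> 2 * (cmod a)\<^sup>2 + 2 * (cmod b)\<^sup>2"
proof -
  have "(cmod (a + b))\<^sup>2 \<le> (cmod a + cmod b)\<^sup>2"
    by (intro power_mono norm_triangle_ineq) auto
  also have "\<dots> \<le> 2 * (cmod a)\<^sup>2 + 2 * (cmod b)\<^sup>2"
    using zero_le_power2[of "cmod a - cmod b"] by (simp add: power2_eq_square algebra_simps)
  finally show ?thesis .
qed

lemma square_integrable_add:
  fixes f g :: "'a \<Rightarrow> complex"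
  assumes [measurable]: "f \<in> borel_measurable M" "g \<in> borel_measurable M"
    and "integrable M (\<lambda>x. (cmod (f x))\<^sup>2)" "integrable M (\<lambda>x. (cmod (g x))\<^sup>2)"
  shows "integrable M (\<lambda>x. (cmod (f x + g x))\<^sup>2)"
  by (rule Bochner_Integration.integrable_bound
        [of M "\<lambda>x. 2 * (cmod (f x))\<^sup>2 + 2 * (cmod (g x))\<^sup>2"])
     (use assms cmod_add_sq_le in auto)

lemma square_integrable_diff:
  fixes f g :: "'a \<Rightarrow> complex"
  assumes [measurable]: "f \<in> borel_measurable M" "g \<in> borel_measurable M"
    and "integrable M (\<lambda>x. (cmod (f x))\<^sup>2)" "integrable M (\<lambda>x. (cmod (g x))\<^sup>2)"
  shows "integrable M (\<lambda>x. (cmod (f x - g x))\<^sup>2)"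
  using square_integrable_add[of f M "\<lambda>x. - g x"] assms by simp

lemma integrable_scaleR_L2:
  fixes f :: "'a \<Rightarrow> real" and g :: "'a \<Rightarrow> complex"
  assumes [measurable]: "f \<in> borel_measurable M" "g \<in> borel_measurable M"
    and f: "integrable M (\<lambda>x. (f x)\<^sup>2)" and g: "integrable M (\<lambda>x. (cmod (g x))\<^sup>2)"
  shows "integrable M (\<lambda>x. f x *\<^sub>R g x)"
proof (rule Bochner_Integration.integrable_bound
        [of M "\<lambda>x. (f x)\<^sup>2 + (cmod (g x))\<^sup>2"])
  show "AE x in M. norm (f x *\<^sub>R g x) \<le> norm ((f x)\<^sup>2 + (cmod (g x))\<^sup>2)"
  proof (rule AE_I2)
    fix x
    have "2 * (\<bar>f x\<bar> * cmod (g x)) \<le> (f x)\<^sup>2 + (cmod (g x))\<^sup>2"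
      using zero_le_power2[of "\<bar>f x\<bar> - cmod (g x)"]
      by (simp add: power2_eq_square algebra_simps)
    moreover have "0 \<le> \<bar>f x\<bar> * cmod (g x)" by simp
    ultimately show "norm (f x *\<^sub>R g x) \<le> norm ((f x)\<^sup>2 + (cmod (g x))\<^sup>2)"
      by (smt (verit) norm_scaleR real_norm_def)
  qed
qed (use f g in auto)

lemma Cauchy_Schwarz_scaleR:
  fixes f :: "'a \<Rightarrow> real" and g :: "'a \<Rightarrow> complex"
  assumes [measurable]: "f \<in> borel_measurable M" "g \<in> borel_measurable M"
    and f: "integrable M (\<lambda>x. (f x)\<^sup>2)" and g: "integrable M (\<lambda>x. (cmod (g x))\<^sup>2)"
  shows "(cmod (\<integral>x. f x *\<^sub>R g x \<partial>M))\<^sup>2 \<le> (\<integral>x. (f x)\<^sup>2 \<partial>M) * (\<integral>x. (cmod (g x))\<^sup>2 \<partial>M)"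
proof -
  have "ennreal (cmod (\<integral>x. f x *\<^sub>R g x \<partial>M)) \<le> (\<integral>\<^sup>+x. norm (f x *\<^sub>R g x) \<partial>M)"
    by (rule integral_norm_bound_ennreal[OF integrable_scaleR_L2[OF assms]])
  also have "\<dots> = (\<integral>\<^sup>+x. ennreal \<bar>f x\<bar> * ennreal (cmod (g x)) \<partial>M)"
    by (simp add: ennreal_mult)
  finally have "(ennreal (cmod (\<integral>x. f x *\<^sub>R g x \<partial>M)))\<^sup>2
      \<le> (\<integral>\<^sup>+x. ennreal \<bar>f x\<bar> * ennreal (cmod (g x)) \<partial>M)\<^sup>2"
    by (intro power_mono) auto
  also have "\<dots> \<le> (\<integral>\<^sup>+x. (ennreal \<bar>f x\<bar>)\<^sup>2 \<partial>M) * (\<integral>\<^sup>+x. (ennreal (cmod (g x)))\<^sup>2 \<partial>M)"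
    by (rule Cauchy_Schwarz_nn_integral) auto
  also have "\<dots> = ennreal (\<integral>x. (f x)\<^sup>2 \<partial>M) * ennreal (\<integral>x. (cmod (g x))\<^sup>2 \<partial>M)"
    using nn_integral_eq_integral[OF f] nn_integral_eq_integral[OF g]
    by (simp add: ennreal_power)
  finally show ?thesis
    by (simp add: ennreal_power ennreal_mult'[symmetric])
qed

text \<open>
  Along a subsequence with \<open>\<parallel>g (r (k+1)) - g (r k)\<parallel>\<^sup>2 \<le> 8^(-k)\<close> the weighted series
  \<open>\<Sum> 2^k \<bar>g (r (k+1)) - g (r k)\<bar>\<^sup>2\<close> has finite integral, hence is finite almost everywhere, and this
  forces pointwise convergence. Fatou's lemma turns the pointwise limit into an \<open>L\<^sup>2\<close> limit. The
  subsequence is part of the conclusion because Fatou's lemma is applied to it again later.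
\<close>

lemma L2_complete:
  fixes g :: "nat \<Rightarrow> 'a \<Rightarrow> complex"
  assumes [measurable]: "\<And>n. g n \<in> borel_measurable M"
    and g2: "\<And>n. integrable M (\<lambda>x. (cmod (g n x))\<^sup>2)"
    and Cauchy: "\<And>e. 0 < e \<Longrightarrow> \<exists>N. \<forall>m\<ge>N. \<forall>n\<ge>N. (\<integral>x. (cmod (g m x - g n x))\<^sup>2 \<partial>M) \<le> e"
  obtains G r where "G \<in> borel_measurable M" "integrable M (\<lambda>x. (cmod (G x))\<^sup>2)"
    "strict_mono (r :: nat \<Rightarrow> nat)" "AE x in M. (\<lambda>k. g (r k) x) \<longlonglongrightarrow> G x"
    "(\<lambda>n. \<integral>x. (cmod (g n x - G x))\<^sup>2 \<partial>M) \<longlonglongrightarrow> 0"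
proof -
  have int: "integrable M (\<lambda>x. (cmod (g m x - g n x))\<^sup>2)" for m n
    by (intro square_integrable_diff g2) auto
  have "\<exists>N. \<forall>m\<ge>N. \<forall>n\<ge>N. (\<integral>x. (cmod (g m x - g n x))\<^sup>2 \<partial>M) \<le> (1/8)^k" for k :: nat
    by (rule Cauchy) simp
  then obtain N0 where N0: "\<And>k m n. N0 k \<le> m \<Longrightarrow> N0 k \<le> n \<Longrightarrow>
      (\<integral>x. (cmod (g m x - g n x))\<^sup>2 \<partial>M) \<le> (1/8)^k"
    by metis
  define r where "r = rec_nat (N0 0) (\<lambda>k a. max (N0 (Suc k)) (Suc a))"
  have r_Suc: "r (Suc k) = max (N0 (Suc k)) (Suc (r k))" and r_0: "r 0 = N0 0" for k
    by (simp_all add: r_def)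
  have mono: "strict_mono r"
    by (rule strict_mono_Suc_iff[THEN iffD2]) (auto simp: r_Suc)
  have rN: "N0 k \<le> r k" for k
    by (cases k) (auto simp: r_Suc r_0)
  have step: "(\<integral>x. (cmod (g (r (Suc k)) x - g (r k) x))\<^sup>2 \<partial>M) \<le> (1/8)^k" for k
    by (rule N0) (use rN[of k] strict_monoD[OF mono, of k "Suc k"] in auto)
  define S where "S x = (\<Sum>k. ennreal (2^k * (cmod (g (r (Suc k)) x - g (r k) x))\<^sup>2))" for x
  have [measurable]: "S \<in> borel_measurable M" unfolding S_def by measurable
  have "(\<integral>\<^sup>+x. S x \<partial>M) = (\<Sum>k. \<integral>\<^sup>+x. ennreal (2^k * (cmod (g (r (Suc k)) x - g (r k) x))\<^sup>2) \<partial>M)"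
    unfolding S_def by (rule nn_integral_suminf) simp
  also have "\<dots> = (\<Sum>k. ennreal (\<integral>x. 2^k * (cmod (g (r (Suc k)) x - g (r k) x))\<^sup>2 \<partial>M))"
    by (intro suminf_cong nn_integral_eq_integral) (use int in auto)
  also have "\<dots> \<le> (\<Sum>k. ennreal ((1/4)^k))"
  proof (rule suminf_le)
    fix k
    have "2^k * (\<integral>x. (cmod (g (r (Suc k)) x - g (r k) x))\<^sup>2 \<partial>M) \<le> 2^k * (1/8)^k"
      using step[of k] by (intro mult_left_mono) auto
    also have "\<dots> = (1/4::real)^k" by (simp only: power_mult_distrib[symmetric]) simp
    finally show "ennreal (\<integral>x. 2^k * (cmod (g (r (Suc k)) x - g (r k) x))\<^sup>2 \<partial>M) \<le> ennreal ((1/4)^k)"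
      by (intro ennreal_leI) simp
  qed auto
  also have "\<dots> = ennreal (\<Sum>k. (1/4)^k)"
    by (rule suminf_ennreal2) (auto intro: summable_geometric)
  also have "\<dots> < \<infinity>" by simp
  finally have "AE x in M. S x \<noteq> \<infinity>"
    by (intro nn_integral_PInf_AE) auto
  then have conv: "AE x in M. convergent (\<lambda>k. g (r k) x)"
  proof eventually_elim
    case (elim x)
    let ?d = "\<lambda>k. cmod (g (r (Suc k)) x - g (r k) x)"
    have sm: "summable (\<lambda>k. 2^k * (?d k)\<^sup>2)"
      by (rule summable_suminf_not_top) (use elim in \<open>auto simp: S_def\<close>)
    have sm': "summable (\<lambda>k. 2^k * (?d k)\<^sup>2 + (1/2)^k)"
      by (intro summable_add sm summable_geometric) simp
    \<comment> \<open>the arithmetic-geometric mean inequality for \<open>d = (2^(k/2) d) 2^(-k/2)\<close>\<close>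
    have le: "?d k \<le> 2^k * (?d k)\<^sup>2 + (1/2)^k" for k
    proof -
      have "0 \<le> (2^k * ?d k - 1)\<^sup>2 + 2^k * ?d k" by simp
      then have "2^k * ?d k \<le> 2^k * (2^k * (?d k)\<^sup>2 + (1/2)^k)"
        by (simp add: power2_eq_square algebra_simps power_divide)
      then show ?thesis by (simp only: mult_le_cancel_left_pos zero_less_power zero_less_numeral)
    qed
    have "summable (\<lambda>k. g (r (Suc k)) x - g (r k) x)"
      by (rule summable_comparison_test'[OF sm', of 0]) (rule le)
    then have "convergent (\<lambda>n. g (r 0) x + (\<Sum>k<n. g (r (Suc k)) x - g (r k) x))"
      by (intro convergent_add convergent_const) (simp add: summable_iff_convergent)
    moreover have "g (r 0) x + (\<Sum>k<n. g (r (Suc k)) x - g (r k) x) = g (r n) x" for n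
      by (subst sum_lessThan_telescope) simp
    ultimately show ?case by simp
  qed
  define G where "G x = lim (\<lambda>k. g (r k) x)" for x
  have [measurable]: "G \<in> borel_measurable M"
    unfolding G_def by measurable
  have lim: "AE x in M. (\<lambda>k. g (r k) x) \<longlonglongrightarrow> G x"
    using conv by eventually_elim (simp add: G_def convergent_LIMSEQ_iff)
  have tail: "integrable M (\<lambda>x. (cmod (G x - g n x))\<^sup>2) \<and> (\<integral>x. (cmod (G x - g n x))\<^sup>2 \<partial>M) \<le> (1/8)^k"
    if "N0 k \<le> n" for n k
  proof (rule fatou_bound[where h="\<lambda>i x. (cmod (g (r (i + k)) x - g n x))\<^sup>2" and b="\<lambda>_. (1/8)^k"])
    show "AE x in M. (\<lambda>i. (cmod (g (r (i + k)) x - g n x))\<^sup>2) \<longlonglongrightarrow> (cmod (G x - g n x))\<^sup>2"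
      using lim
    proof eventually_elim
      case (elim x)
      show ?case by (intro tendsto_intros LIMSEQ_ignore_initial_segment[OF elim])
    qed
    show "(\<integral>x. (cmod (g (r (i + k)) x - g n x))\<^sup>2 \<partial>M) \<le> (1/8)^k" for i
    proof (rule N0)
      show "N0 k \<le> r (i + k)"
        using rN[of k] strict_mono_leD[OF mono, of k "i + k"] by simp
    qed (use that in auto)
  qed (auto intro: int)
  have "integrable M (\<lambda>x. (cmod ((G x - g (N0 0) x) + g (N0 0) x))\<^sup>2)"
    by (intro square_integrable_add g2) (use tail[of 0 "N0 0"] in auto)
  then have G2: "integrable M (\<lambda>x. (cmod (G x))\<^sup>2)" by simp
  have "(\<lambda>n. \<integral>x. (cmod (g n x - G x))\<^sup>2 \<partial>M) \<longlonglongrightarrow> 0"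
  proof (rule LIMSEQ_I)
    fix e :: real assume "0 < e"
    then obtain k :: nat where k: "(1/8)^k < e"
      using real_arch_pow_inv[of e "1/8"] by auto
    show "\<exists>no. \<forall>n\<ge>no. norm ((\<integral>x. (cmod (g n x - G x))\<^sup>2 \<partial>M) - 0) < e"
      using tail[of k] k by (intro exI[of _ "N0 k"]) (force simp: norm_minus_commute)
  qed
  with that[OF _ G2 mono lim] show thesis by auto
qed

section \<open>Weak derivatives and the fundamental theorem of calculus\<close>

abbreviation leb_on :: "real set \<Rightarrow> real measure" where
  "leb_on I \<equiv> restrict_space lborel I"

text \<open>
  Integrals over \<open>I\<close> are moved to the measure \<open>leb_on I\<close>, for which the lemmas on
  \<open>L\<^sup>2\<close> of an arbitrary measure apply.
\<close>

lemma set_lint_eq: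
  fixes h :: "real \<Rightarrow> 'b::{banach, second_countable_topology}"
  assumes "I \<in> sets borel"
  shows "(LINT x:I|lborel. h x) = (\<integral>x. h x \<partial>leb_on I)"
  using assms by (simp add: integral_restrict_space set_lebesgue_integral_def)

lemma set_integrable_eq:
  fixes h :: "real \<Rightarrow> 'b::{banach, second_countable_topology}"
  assumes "I \<in> sets borel"
  shows "set_integrable lborel I h \<longleftrightarrow> integrable (leb_on I) h"
  using assms by (simp add: integrable_restrict_space set_integrable_def)

lemma L2_on_iff:
  assumes "I \<in> sets borel"
  shows "L2_on I f \<longleftrightarrow>
    f \<in> borel_measurable (leb_on I) \<and> integrable (leb_on I) (\<lambda>x. (cmod (f x))\<^sup>2)"
  using assms
  by (simp add: L2_on_def set_integrable_eq set_borel_measurable_def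
      borel_measurable_restrict_space_iff)

text \<open>
  The derivative of a test function vanishes off the support, because the complement of the closed
  support is an open set on which the function is constant.
\<close>

lemma test_functionE:
  assumes "test_function I \<phi>"
  obtains K where "compact K" "K \<subseteq> interior I" "\<And>x. x \<notin> K \<Longrightarrow> \<phi> x = 0"
    "\<And>x. x \<notin> K \<Longrightarrow> deriv \<phi> x = 0" "continuous_on UNIV \<phi>" "continuous_on UNIV (deriv \<phi>)"
    "\<And>x. (\<phi> has_real_derivative deriv \<phi> x) (at x)"
proof -
  let ?K = "closure {x. \<phi> x \<noteq> 0}"
  obtain D where D: "\<And>x. (\<phi> has_vector_derivative D x) (at x)" and cD: "continuous_on UNIV D"
    using assms unfolding test_function_def C1_differentiable_on_def by auto
  have D': "(\<phi> has_real_derivative D x) (at x)" for x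
    using D by (simp add: has_real_derivative_iff_has_vector_derivative)
  then have eq: "deriv \<phi> = D"
    by (intro ext DERIV_imp_deriv)
  have zero: "\<phi> x = 0" if "x \<notin> ?K" for x
    using that closure_subset[of "{x. \<phi> x \<noteq> 0}"] by auto
  have zero': "deriv \<phi> x = 0" if "x \<notin> ?K" for x
  proof (rule DERIV_imp_deriv)
    show "(\<phi> has_real_derivative 0) (at x)"
    proof (rule has_field_derivative_transform_within_open)
      show "((\<lambda>_. 0) has_real_derivative 0) (at x)" by (rule DERIV_const)
      show "open (- ?K)" by (rule open_Compl[OF closed_closure])
      show "x \<in> - ?K" by (metis ComplI that)
      show "0 = \<phi> y" if "y \<in> - ?K" for y by (metis ComplD that zero)
    qed
  qed
  have cont: "continuous_on UNIV \<phi>"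
    using D' by (meson DERIV_continuous continuous_at_imp_continuous_on)
  have K: "compact ?K" "?K \<subseteq> interior I"
    using assms by (simp_all only: test_function_def)
  show thesis
    by (rule that[of ?K, OF K zero zero' cont]) (use cD D' in \<open>simp_all add: eq\<close>)
qed

lemma integrable_compact_support:
  fixes \<psi> :: "real \<Rightarrow> 'b::{banach, second_countable_topology}"
  assumes "compact K" "\<And>x. x \<notin> K \<Longrightarrow> \<psi> x = 0" "continuous_on UNIV \<psi>"
  shows "integrable lborel \<psi>"
proof -
  have "integrable lborel (\<lambda>x. if x \<in> K then \<psi> x else 0)"
    using borel_integrable_compact[OF assms(1), of \<psi>] assms(3) continuous_on_subset
    by (simp add: indicator_scaleR_eq_if) blast
  moreover have "(\<lambda>x. if x \<in> K then \<psi> x else 0) = \<psi>"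
    using assms(2) by auto
  ultimately show ?thesis by simp
qed

lemma square_integrable_compact_support:
  fixes \<psi> :: "real \<Rightarrow> real"
  assumes "I \<in> sets borel" "compact K" "\<And>x. x \<notin> K \<Longrightarrow> \<psi> x = 0" "continuous_on UNIV \<psi>"
  shows "integrable (leb_on I) (\<lambda>x. (\<psi> x)\<^sup>2)"
proof -
  have "integrable lborel (\<lambda>x. (\<psi> x)\<^sup>2)"
    by (rule integrable_compact_support[OF assms(2)]) (use assms in \<open>auto intro!: continuous_intros\<close>)
  then show ?thesis
    using assms(1) by (simp add: integrable_restrict_space integrable_mult_indicator del: real_scaleR_def)
qed

lemma measurable_leb_on_continuous:
  fixes \<psi> :: "real \<Rightarrow> 'b::topological_space"
  assumes "continuous_on UNIV \<psi>"
  shows "\<psi> \<in> borel_measurable (leb_on I)"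
  by (rule measurable_restrict_space1) (use borel_measurable_continuous_onI[OF assms] in simp)

lemma integrable_compact_support_L2:
  fixes \<psi> :: "real \<Rightarrow> real"
  assumes I: "I \<in> sets borel" and "compact K" "\<And>x. x \<notin> K \<Longrightarrow> \<psi> x = 0" "continuous_on UNIV \<psi>"
    and "L2_on I g"
  shows "integrable (leb_on I) (\<lambda>x. \<psi> x *\<^sub>R g x)"
  using assms square_integrable_compact_support[OF assms(1-4)] measurable_leb_on_continuous[of \<psi> I]
  by (intro integrable_scaleR_L2) (auto simp: L2_on_iff)

lemma test_function_integrable:
  assumes "I \<in> sets borel" "test_function I \<phi>" "L2_on I g"
  shows "integrable (leb_on I) (\<lambda>x. \<phi> x *\<^sub>R g x)"
    and "integrable (leb_on I) (\<lambda>x. deriv \<phi> x *\<^sub>R g x)"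
proof -
  show "integrable (leb_on I) (\<lambda>x. \<phi> x *\<^sub>R g x)"
    by (rule test_functionE[OF assms(2)],
        rule integrable_compact_support_L2[OF assms(1) _ _ _ assms(3)])
  show "integrable (leb_on I) (\<lambda>x. deriv \<phi> x *\<^sub>R g x)"
    by (rule test_functionE[OF assms(2)],
        rule integrable_compact_support_L2[OF assms(1) _ _ _ assms(3)])
qed

lemma weak_derivative_iff:
  assumes "I \<in> sets borel"
  shows "has_weak_derivative_on I f g \<longleftrightarrow>
     (\<forall>\<phi>. test_function I \<phi> \<longrightarrow>
        (\<integral>x. deriv \<phi> x *\<^sub>R f x \<partial>leb_on I) = - (\<integral>x. \<phi> x *\<^sub>R g x \<partial>leb_on I))"
  using assms by (simp add: has_weak_derivative_on_def set_lint_eq)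

lemma L2_on_add:
  assumes "I \<in> sets borel" "L2_on I f" "L2_on I g"
  shows "L2_on I (\<lambda>x. f x + g x)"
  using assms by (auto simp: L2_on_iff intro!: square_integrable_add)

lemma L2_on_cmult:
  assumes "I \<in> sets borel" "L2_on I f"
  shows "L2_on I (\<lambda>x. of_real c * f x)"
  using assms by (auto simp: L2_on_iff norm_mult power_mult_distrib)

lemma L2_on_diff:
  assumes "I \<in> sets borel" "L2_on I f" "L2_on I g"
  shows "L2_on I (\<lambda>x. f x - g x)"
  using assms by (auto simp: L2_on_iff intro!: square_integrable_diff)

lemma weak_derivative_add:
  assumes I: "I \<in> sets borel" and L2: "L2_on I f" "L2_on I g" "L2_on I f'" "L2_on I g'"
    and "has_weak_derivative_on I f f'" "has_weak_derivative_on I g g'"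
  shows "has_weak_derivative_on I (\<lambda>x. f x + g x) (\<lambda>x. f' x + g' x)"
  using assms by (simp add: weak_derivative_iff scaleR_add_right test_function_integrable)

lemma weak_derivative_cmult:
  assumes I: "I \<in> sets borel" 
    and "has_weak_derivative_on I f f'"
  shows "has_weak_derivative_on I (\<lambda>x. of_real c * f x) (\<lambda>x. of_real c * f' x)"
  using assms by (simp add: weak_derivative_iff flip: mult_scaleR_right)

lemma L2_on_imp_set_integrable:
  assumes I: "I \<in> sets borel" and A: "A \<in> sets borel" "A \<subseteq> I" "emeasure lborel A < \<infinity>"
    and g: "L2_on I g"
  shows "set_integrable lborel A g"
proof -
  have "integrable (leb_on I) (\<lambda>x. (indicator A x :: real) *\<^sub>R g x)"
  proof (rule integrable_scaleR_L2)
    have "integrable lborel (indicat_real A)"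
      by (rule integrable_real_indicator) (use A in auto)
    then have "integrable lborel (\<lambda>x. indicator I x *\<^sub>R (indicator A x :: real))"
      by (intro integrable_mult_indicator) (use I in auto)
    then have "integrable (leb_on I) (\<lambda>x. indicator A x :: real)"
      using I by (simp add: integrable_restrict_space)
    then show "integrable (leb_on I) (\<lambda>x. (indicator A x :: real)\<^sup>2)"
      by (simp flip: indicator_inter_arith add: power2_eq_square)
  qed (use I g A in \<open>auto simp: L2_on_iff intro!: measurable_restrict_space1\<close>)
  then have "integrable lborel (\<lambda>x. indicator I x *\<^sub>R (indicator A x :: real) *\<^sub>R g x)"
    using I by (simp add: integrable_restrict_space)
  moreover have "(\<lambda>x. indicator I x *\<^sub>R (indicator A x :: real) *\<^sub>R g x)
      = (\<lambda>x. indicator A x *\<^sub>R g x)"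
  proof (rule ext)
    fix x
    show "indicator I x *\<^sub>R (indicator A x :: real) *\<^sub>R g x = indicator A x *\<^sub>R g x"
      using A by (cases "x \<in> A") auto
  qed
  ultimately show ?thesis unfolding set_integrable_def by metis
qed

lemma integrable_on_subinterval:
  assumes "I \<in> sets borel" "{a..b} \<subseteq> I" "L2_on I g"
  shows "set_integrable lborel {a..b} g"
  using assms by (intro L2_on_imp_set_integrable) (auto simp: emeasure_lborel_Icc_eq)

text \<open>
  Test functions only have to be of class \<open>C\<^sup>1\<close>, so they can be assembled from truncated squares.
\<close>

lemma DERIV_pos_part_square: "((\<lambda>x::real. (max 0 x)\<^sup>2) has_real_derivative 2 * max 0 x) (at x)"
proof -
  consider "x < 0" | "x > 0" | "x = 0" by linarith
  then show ?thesis
  proof cases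
    case 1
    show ?thesis
      by (rule has_field_derivative_transform_within_open[of "\<lambda>_. 0" _ _ "{..<0}"]) (use 1 in auto)
  next
    case 2
    show ?thesis
      by (rule has_field_derivative_transform_within_open[of "\<lambda>x. x\<^sup>2" _ _ "{0<..}"])
         (use 2 in \<open>auto intro!: derivative_eq_intros\<close>)
  next
    case 3
    have "((\<lambda>y::real. (max 0 y)\<^sup>2 / y) \<longlongrightarrow> 0) (at 0)"
    proof (rule Lim_null_comparison[where g="\<lambda>y. \<bar>y\<bar>"])
      show "\<forall>\<^sub>F y::real in at 0. norm ((max 0 y)\<^sup>2 / y) \<le> \<bar>y\<bar>"
        by (intro always_eventually) (auto simp: max_def power2_eq_square)
    qed (auto intro!: tendsto_eq_intros)
    then show ?thesis using 3 by (simp add: has_field_derivative_iff)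
  qed
qed

text \<open>
  A quadratic spline of class \<open>C\<^sup>1\<close> rising from \<open>0\<close> at \<open>x \<le> 0\<close> to \<open>1\<close> at \<open>x \<ge> 1\<close>; its
  derivative is the triangular bump of unit mass on \<open>[0, 1]\<close>.
\<close>

definition ramp :: "real \<Rightarrow> real" where
  "ramp x = 2 * ((max 0 x)\<^sup>2 - 2 * (max 0 (x - 1/2))\<^sup>2 + (max 0 (x - 1))\<^sup>2)"

definition tent :: "real \<Rightarrow> real" where
  "tent x = 4 * (max 0 x - 2 * max 0 (x - 1/2) + max 0 (x - 1))"

lemma ramp_le_0: "x \<le> 0 \<Longrightarrow> ramp x = 0"
  by (simp add: ramp_def)

lemma ramp_ge_1: "1 \<le> x \<Longrightarrow> ramp x = 1"
  by (simp add: ramp_def max_def power2_eq_square algebra_simps)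

lemma tent_eq_0: "x \<le> 0 \<or> 1 \<le> x \<Longrightarrow> tent x = 0"
  by (auto simp: tent_def max_def)

lemma tent_nonneg: "0 \<le> tent x"
  by (auto simp: tent_def max_def)

lemma continuous_on_tent: "continuous_on A tent"
  unfolding tent_def by (intro continuous_intros)

lemma DERIV_ramp: "(ramp has_real_derivative tent x) (at x)"
proof -
  have "((\<lambda>x. (max 0 (x - c))\<^sup>2) has_real_derivative 2 * max 0 (x - c)) (at x)" for c :: real
    using DERIV_shift[of "\<lambda>x. (max 0 x)\<^sup>2" "2 * max 0 (x - c)" x "- c"]
      DERIV_pos_part_square[of "x - c"] by simp
  then have "((\<lambda>x. 2 * ((max 0 (x - 0))\<^sup>2 - 2 * (max 0 (x - 1/2))\<^sup>2 + (max 0 (x - 1))\<^sup>2))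
      has_real_derivative 2 * (2 * max 0 (x - 0) - 2 * (2 * max 0 (x - 1/2)) + 2 * max 0 (x - 1))) (at x)"
    by (intro DERIV_add DERIV_diff DERIV_cmult)
  then show ?thesis
    by (simp add: ramp_def[abs_def] tent_def algebra_simps)
qed

lemma ramp_bounds: "0 \<le> ramp x" "ramp x \<le> 1"
proof -
  have mono: "ramp a \<le> ramp b" if "a \<le> b" for a b
    by (rule DERIV_nonneg_imp_nondecreasing[OF that]) (use DERIV_ramp tent_nonneg in blast)
  show "0 \<le> ramp x" using mono[of "min x 0" x] by (simp add: ramp_le_0)
  show "ramp x \<le> 1" using mono[of x "max x 1"] by (simp add: ramp_ge_1)
qed

lemma integral_tent: "integrable lborel tent" "(\<integral>x. tent x \<partial>lborel) = 1"
proof -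
  show "integrable lborel tent"
    by (rule integrable_compact_support[OF compact_Icc[of 0 1] _ continuous_on_tent])
       (auto simp: tent_def max_def)
  have "(\<integral>x. tent x * indicator {0..1} x \<partial>lborel) = ramp 1 - ramp 0"
    by (rule integral_FTC_Icc_real)
       (use DERIV_ramp continuous_on_tent[of UNIV] in \<open>auto simp: continuous_on_eq_continuous_at\<close>)
  moreover have "tent x * indicator {0..1} x = tent x" for x
    by (auto simp: indicator_def tent_def max_def)
  ultimately show "(\<integral>x. tent x \<partial>lborel) = 1"
    by (simp add: ramp_le_0 ramp_ge_1)
qed

text \<open>
  The rescaled bumps are an approximate identity at \<open>a\<close>, even though their supports drift towards
  \<open>a\<close> from one side.
\<close>

lemma tent_average_tendsto:
  fixes F :: "real \<Rightarrow> complex"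
  assumes F: "continuous_on UNIV F" and B: "\<And>x. cmod (F x) \<le> B"
    and c: "c \<longlonglongrightarrow> a" and e: "\<epsilon> \<longlonglongrightarrow> 0" and pos: "\<And>n. 0 < \<epsilon> n"
  shows "(\<lambda>n. \<integral>x. (tent ((x - c n) / \<epsilon> n) / \<epsilon> n) *\<^sub>R F x \<partial>lborel) \<longlonglongrightarrow> F a"
proof -
  have [measurable]: "F \<in> borel_measurable borel" "tent \<in> borel_measurable borel"
    using F continuous_on_tent by (auto intro: borel_measurable_continuous_onI)
  have eq: "(\<integral>x. (tent ((x - c n) / \<epsilon> n) / \<epsilon> n) *\<^sub>R F x \<partial>lborel)
      = (\<integral>t. tent t *\<^sub>R F (c n + \<epsilon> n * t) \<partial>lborel)" for n
    using pos[of n]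
    by (subst lborel_integral_real_affine[of "\<epsilon> n" _ "c n"])
       (simp_all flip: integral_scaleR_right)
  have "(\<lambda>n. \<integral>t. tent t *\<^sub>R F (c n + \<epsilon> n * t) \<partial>lborel) \<longlonglongrightarrow> (\<integral>t. tent t *\<^sub>R F a \<partial>lborel)"
  proof (rule integral_dominated_convergence[where w="\<lambda>t. B * tent t"])
    show "AE t in lborel. (\<lambda>n. tent t *\<^sub>R F (c n + \<epsilon> n * t)) \<longlonglongrightarrow> tent t *\<^sub>R F a"
    proof (rule AE_I2)
      fix t
      have "(\<lambda>n. c n + \<epsilon> n * t) \<longlonglongrightarrow> a + 0 * t"
        by (intro tendsto_intros c e)
      moreover have "isCont F (a + 0 * t)"
        using F by (simp add: continuous_on_eq_continuous_at)
      ultimately show "(\<lambda>n. tent t *\<^sub>R F (c n + \<epsilon> n * t)) \<longlonglongrightarrow> tent t *\<^sub>R F a"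
        by (intro tendsto_intros) (use isCont_tendsto_compose in fastforce)
    qed
    show "AE t in lborel. norm (tent t *\<^sub>R F (c n + \<epsilon> n * t)) \<le> B * tent t" for n
      by (intro AE_I2) (use B tent_nonneg in \<open>auto simp: mult.commute[of B] intro!: mult_mono\<close>)
  qed (use integral_tent in auto)
  also have "(\<integral>t. tent t *\<^sub>R F a \<partial>lborel) = F a"
    using integral_tent by simp
  finally show ?thesis by (simp add: eq)
qed

text \<open>
  Testing with a smoothed indicator \<open>\<phi>\<close> of \<open>[a, b]\<close>: its derivative is a unit bump near \<open>a\<close> minus
  a unit bump near \<open>b\<close>, so the two sides of the definition tend to \<open>f a - f b\<close> and to
  \<open>- \<integral> g\<close>. The bumps are placed in \<open>[a + \<epsilon>, a + 2\<epsilon>]\<close> and \<open>[b - 2\<epsilon>, b - \<epsilon>]\<close>, which keeps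
  the support in the interior of \<open>I\<close> even if \<open>a\<close> or \<open>b\<close> is an endpoint of \<open>I\<close>; one-sided
  continuity of \<open>f\<close> is enough.
\<close>

lemma weak_derivative_FTC:
  assumes I: "I \<in> sets borel" and wd: "has_weak_derivative_on I f g" and g: "L2_on I g"
    and ab: "a \<le> b" "{a..b} \<subseteq> I" and f: "continuous_on {a..b} f"
  shows "f b - f a = (LINT x:{a..b}|lborel. g x)"
proof (cases "a = b")
  case True
  have "(LINT x:{b}|lborel. g x) = 0"
    unfolding set_lebesgue_integral_def
    by (rule integral_eq_zero_AE, use AE_lborel_singleton[of b] in eventually_elim)
       (simp add: indicator_def)
  with True show ?thesis by simp
next
  case False
  with ab have "a < b" by simp
  \<comment> \<open>a continuous extension of \<open>f\<close> to the line, so that the bumps may be averaged over the line\<close>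
  define F where "F x = f (max a (min b x))" for x
  have F: "continuous_on UNIV F"
    unfolding F_def
    by (rule continuous_on_compose2[OF f]) (use ab in \<open>auto intro!: continuous_intros\<close>)
  have Ff: "F x = f x" if "x \<in> {a..b}" for x
    using that by (auto simp: F_def max_def min_def dest: antisym)
  obtain B where B: "\<And>x. x \<in> {a..b} \<Longrightarrow> cmod (f x) \<le> B"
    using compact_imp_bounded[OF compact_continuous_image[OF f compact_Icc]]
    unfolding bounded_iff by blast
  have FB: "cmod (F x) \<le> B" for x
    unfolding F_def by (rule B) (use ab in auto)
  define \<epsilon> where "\<epsilon> n = (b - a) / (3 + real n)" for n
  have \<epsilon>: "0 < \<epsilon> n" "3 * \<epsilon> n \<le> b - a" for n
    using \<open>a < b\<close> mult_nonneg_nonneg[of "b - a" "real n"] by (auto simp: \<epsilon>_def field_simps)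
  have \<epsilon>0: "\<epsilon> \<longlonglongrightarrow> 0"
      unfolding \<epsilon>_def by (intro real_tendsto_divide_at_top[OF tendsto_const]
        filterlim_tendsto_add_at_top[OF tendsto_const filterlim_real_sequentially])
  define \<phi> where "\<phi> n x = ramp ((x - (a + \<epsilon> n)) / \<epsilon> n) - ramp ((x - (b - 2 * \<epsilon> n)) / \<epsilon> n)" for n x
  define \<psi> where "\<psi> n x = tent ((x - (a + \<epsilon> n)) / \<epsilon> n) / \<epsilon> n - tent ((x - (b - 2 * \<epsilon> n)) / \<epsilon> n) / \<epsilon> n" for n x
  have D: "(\<phi> n has_real_derivative \<psi> n x) (at x)" for n x
    unfolding \<phi>_def \<psi>_def using \<epsilon>(1)[of n]
    by (auto intro!: derivative_eq_intros DERIV_chain2[where f=ramp, OF DERIV_ramp])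
  have zero: "\<phi> n x = 0" "\<psi> n x = 0" if "x \<notin> {a + \<epsilon> n..b - \<epsilon> n}" for n x
  proof -
    have "x \<le> a + \<epsilon> n \<and> x \<le> b - 2 * \<epsilon> n \<or> b - \<epsilon> n \<le> x \<and> a + 2 * \<epsilon> n \<le> x"
      using that \<epsilon>[of n] by auto
    then show "\<phi> n x = 0" "\<psi> n x = 0"
      unfolding \<phi>_def \<psi>_def using \<epsilon>(1)[of n]
      by (auto simp: ramp_le_0 ramp_ge_1 tent_eq_0 field_simps)
  qed
  have c\<psi>: "continuous_on UNIV (\<psi> n)" for n
    unfolding \<psi>_def using \<epsilon>(1)[of n]
    by (intro continuous_intros continuous_on_compose2[OF continuous_on_tent[of UNIV]]) auto
  have d\<phi>: "deriv (\<phi> n) = \<psi> n" for n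
    using D by (intro ext DERIV_imp_deriv)
  have sub: "{x. \<phi> n x \<noteq> 0} \<subseteq> {a + \<epsilon> n..b - \<epsilon> n}" for n
    using zero by blast
  have test: "test_function I (\<phi> n)" for n
    unfolding test_function_def
  proof (intro conjI)
    show "\<phi> n C1_differentiable_on UNIV"
      unfolding C1_differentiable_on_def
      using D c\<psi> by (auto simp: has_real_derivative_iff_has_vector_derivative)
    have cl: "closure {x. \<phi> n x \<noteq> 0} \<subseteq> {a + \<epsilon> n..b - \<epsilon> n}"
      by (rule closure_minimal[OF sub]) simp
    then show "compact (closure {x. \<phi> n x \<noteq> 0})"
      by (meson closed_closure compact_Icc bounded_subset compact_eq_bounded_closed)
    have "{a + \<epsilon> n..b - \<epsilon> n} \<subseteq> {a<..<b}" using \<epsilon>(1)[of n] by auto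
    also have "\<dots> \<subseteq> interior I"
      by (rule interior_maximal) (use ab in auto)
    finally show "closure {x. \<phi> n x \<noteq> 0} \<subseteq> interior I" using cl by blast
  qed
  have inI: "{a + \<epsilon> n..b - \<epsilon> n} \<subseteq> {a..b}" for n using \<epsilon>(1)[of n] by auto
  let ?T = "\<lambda>n c x. (tent ((x - c) / \<epsilon> n) / \<epsilon> n) *\<^sub>R F x"
  have intT: "integrable lborel (?T n c)" for n c
    by (rule integrable_compact_support[of "{c..c + \<epsilon> n}"])
       (use \<epsilon>(1)[of n] F in \<open>auto simp: tent_eq_0 field_simps not_le
          intro!: continuous_intros continuous_on_compose2[OF continuous_on_tent[of UNIV]]\<close>)
  have "(LINT x:I|lborel. deriv (\<phi> n) x *\<^sub>R f x) = (\<integral>x. ?T n (a + \<epsilon> n) x \<partial>lborel) - (\<integral>x. ?T n (b - 2 * \<epsilon> n) x \<partial>lborel)" for n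
  proof -
    have "indicator I x *\<^sub>R (deriv (\<phi> n) x *\<^sub>R f x) = ?T n (a + \<epsilon> n) x - ?T n (b - 2 * \<epsilon> n) x" for x
    proof (cases "x \<in> {a + \<epsilon> n..b - \<epsilon> n}")
      case True
      then have "x \<in> {a..b}" using inI by blast
      then show ?thesis using ab by (auto simp: Ff d\<phi> \<psi>_def scaleR_diff_left)
    next
      case False
      then show ?thesis
        using zero(2)[OF False] by (simp add: d\<phi> flip: scaleR_diff_left) (auto simp: \<psi>_def)
    qed
    then show ?thesis unfolding set_lebesgue_integral_def
      by (simp add: Bochner_Integration.integral_diff[OF intT intT])
  qed
  moreover have "(\<lambda>n. (\<integral>x. ?T n (a + \<epsilon> n) x \<partial>lborel) - (\<integral>x. ?T n (b - 2 * \<epsilon> n) x \<partial>lborel)) \<longlonglongrightarrow> F a - F b"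
    by (intro tendsto_diff tent_average_tendsto[OF F FB _ \<epsilon>0 \<epsilon>(1)])
       (auto intro!: tendsto_eq_intros \<epsilon>0)
  ultimately have lim1: "(\<lambda>n. LINT x:I|lborel. deriv (\<phi> n) x *\<^sub>R f x) \<longlonglongrightarrow> F a - F b"
    by simp
  have gint: "set_integrable lborel {a..b} g"
    by (rule integrable_on_subinterval[OF I ab(2) g])
  have lim2: "(\<lambda>n. LINT x:I|lborel. \<phi> n x *\<^sub>R g x) \<longlonglongrightarrow> (LINT x:{a..b}|lborel. g x)"
    unfolding set_lebesgue_integral_def
  proof (rule integral_dominated_convergence[where w="\<lambda>x. norm (indicator {a..b} x *\<^sub>R g x)"])
    show "integrable lborel (\<lambda>x. norm (indicat_real {a..b} x *\<^sub>R g x))"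
      using gint unfolding set_integrable_def by (rule integrable_norm)
    show "(\<lambda>x. indicat_real {a..b} x *\<^sub>R g x) \<in> borel_measurable lborel"
      using gint unfolding set_integrable_def by (rule borel_measurable_integrable)
    have "integrable (leb_on I) (\<lambda>x. \<phi> n x *\<^sub>R g x)" for n
      by (rule test_function_integrable[OF I test g])
    then have "integrable lborel (\<lambda>x. indicat_real I x *\<^sub>R \<phi> n x *\<^sub>R g x)" for n
      using I by (subst (asm) integrable_restrict_space) simp_all
    then show "(\<lambda>x. indicat_real I x *\<^sub>R \<phi> n x *\<^sub>R g x) \<in> borel_measurable lborel" for n
      by (rule borel_measurable_integrable)
    show "AE x in lborel. norm (indicat_real I x *\<^sub>R \<phi> n x *\<^sub>R g x) \<le> norm (indicat_real {a..b} x *\<^sub>R g x)" for n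
    proof (rule AE_I2)
      fix x
      have "\<bar>\<phi> n x\<bar> \<le> 1"
        unfolding \<phi>_def using ramp_bounds by (smt (verit))
      then show "norm (indicat_real I x *\<^sub>R \<phi> n x *\<^sub>R g x) \<le> norm (indicat_real {a..b} x *\<^sub>R g x)"
        using zero(1)[of x n] inI[of n] by (auto simp: indicator_def mult_left_le_one_le)
    qed
    show "AE x in lborel. (\<lambda>n. indicat_real I x *\<^sub>R \<phi> n x *\<^sub>R g x) \<longlonglongrightarrow> indicat_real {a..b} x *\<^sub>R g x"
      using AE_lborel_singleton[of a] AE_lborel_singleton[of b]
    proof eventually_elim
      case (elim x)
      show ?case
      proof (cases "x \<in> {a..b}")
        case True
        with elim have x: "a < x" "x < b" "x \<in> I" using ab by auto
        have "\<forall>\<^sub>F n in sequentially. \<epsilon> n < min ((x - a) / 2) ((b - x) / 2)"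
          by (rule order_tendstoD(2)[OF \<epsilon>0]) (use x in auto)
        then have "\<forall>\<^sub>F n in sequentially. indicat_real I x *\<^sub>R \<phi> n x *\<^sub>R g x = indicat_real {a..b} x *\<^sub>R g x"
        proof eventually_elim
          case (elim n)
          have "1 \<le> (x - (a + \<epsilon> n)) / \<epsilon> n" "(x - (b - 2 * \<epsilon> n)) / \<epsilon> n \<le> 0"
            using elim \<epsilon>(1)[of n] by (auto simp: field_simps)
          then have "\<phi> n x = 1" by (simp add: \<phi>_def ramp_le_0 ramp_ge_1)
          then show ?case using x True by simp
        qed
        then show ?thesis by (rule tendsto_eventually)
      next
        case False
        then have "\<phi> n x = 0" for n using zero(1)[of x n] inI[of n] by blast
        then show ?thesis using False by simp
      qed
    qed
  qed
  have "(\<lambda>n. LINT x:I|lborel. deriv (\<phi> n) x *\<^sub>R f x) = (\<lambda>n. - (LINT x:I|lborel. \<phi> n x *\<^sub>R g x))"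
    using wd test by (simp add: has_weak_derivative_on_def)
  then have "F a - F b = - (LINT x:{a..b}|lborel. g x)"
    using lim1 tendsto_minus[OF lim2] LIMSEQ_unique by metis
  then show ?thesis
    using Ff ab by (simp add: algebra_simps)
qed

section \<open>Uniqueness, stability and pointwise bounds\<close>

text \<open>
  The sets on which \<open>h\<close>, cut off to the interval, has integral zero form a Dynkin system containing
  the rays \<open>{..t}\<close>, hence contain all Borel sets.
\<close>

lemma AE_zero_of_interval_integrals:
  fixes h :: "real \<Rightarrow> complex"
  assumes int: "set_integrable lborel {\<alpha>..\<beta>} h"
    and zero: "\<And>a b. \<alpha> \<le> a \<Longrightarrow> a \<le> b \<Longrightarrow> b \<le> \<beta> \<Longrightarrow> (LINT x:{a..b}|lborel. h x) = 0"
  shows "AE x in lborel. x \<in> {\<alpha>..\<beta>} \<longrightarrow> h x = 0"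
proof -
  define k where "k x = indicator {\<alpha>..\<beta>} x *\<^sub>R h x" for x
  have k: "integrable lborel k"
    using int by (simp add: k_def[abs_def] set_integrable_def)
  have sk: "set_integrable lborel A k" if "A \<in> sets borel" for A
    unfolding set_integrable_def by (rule integrable_mult_indicator) (use that k in auto)
  have whole: "(LINT x:UNIV|lborel. k x) = 0"
  proof (cases "\<alpha> \<le> \<beta>")
    case True
    then show ?thesis using zero[of \<alpha> \<beta>] by (simp add: k_def set_lebesgue_integral_def)
  next
    case False
    then have "k = (\<lambda>_. 0)" by (auto simp: k_def)
    then show ?thesis by (simp add: set_lebesgue_integral_def)
  qed
  have "(LINT x:A|lborel. k x) = 0" if "A \<in> sets borel" for A
  proof -
    have "Int_stable (range (atMost :: real \<Rightarrow> _))" "range atMost \<subseteq> Pow (UNIV :: real set)"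
      by (auto simp: Int_stable_def)
    moreover have "A \<in> sigma_sets UNIV (range atMost)"
      using that by (simp add: borel_eq_atMost image_def)
    ultimately show ?thesis
    proof (induction rule: sigma_sets_induct_disjoint)
      case (basic A)
      then obtain t where t: "A = {..t}" by auto
      show ?case
      proof (cases "\<alpha> \<le> min t \<beta>")
        case True
        have "indicator {..t} x *\<^sub>R k x = indicator {\<alpha>..min t \<beta>} x *\<^sub>R h x" for x
          by (auto simp: k_def indicator_def)
        then show ?thesis using zero[of \<alpha> "min t \<beta>"] True t
          by (simp add: set_lebesgue_integral_def)
      next
        case False
        then have "(\<lambda>x. indicator {..t} x *\<^sub>R k x) = (\<lambda>_. 0)"
          by (auto simp: k_def indicator_def)
        then show ?thesis unfolding t set_lebesgue_integral_def by (simp only: Bochner_Integration.integral_zero)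
      qed
    next
      case empty
      show ?case by (simp add: set_lebesgue_integral_def)
    next
      case (compl A)
      then have A: "A \<in> sets borel" by (simp add: borel_eq_atMost image_def)
      have "(LINT x:(UNIV - A) \<union> A|lborel. k x) = (LINT x:UNIV - A|lborel. k x) + (LINT x:A|lborel. k x)"
        by (rule set_integral_Un) (use A sk in auto)
      then show ?case using compl whole by simp
    next
      case (union A)
      then have A: "A i \<in> sets borel" for i by (auto simp: borel_eq_atMost image_def)
      have "(LINT x:(\<Union>i. A i)|lborel. k x) = (\<Sum>i. LINT x:A i|lborel. k x)"
        by (rule lebesgue_integral_countable_add)
           (use A sk union in \<open>auto simp: disjoint_family_on_def\<close>)
      then show ?case using union by simp
    qed
  qed
  then have "AE x in lborel. k x = 0"
    by (intro sigma_finite_measure.density_zero[OF sigma_finite_lborel k]) simp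
  then show ?thesis
    by eventually_elim (auto simp: k_def)
qed

text \<open>
  By the fundamental theorem the difference of two weak derivatives has integral zero over every
  compact subinterval. This makes the arbitrary choice in the definition of \<open>weak_deriv\<close> harmless
  for the energy.
\<close>

lemma weak_derivative_unique:
  assumes "closed I" "is_interval I" and f: "continuous_on I f"
    and wd: "has_weak_derivative_on I f g" "has_weak_derivative_on I f g'"
    and L2: "L2_on I g" "L2_on I g'"
  shows "AE x in leb_on I. g x = g' x"
proof -
  have I: "I \<in> sets borel" using assms by auto
  have "AE x in lborel. x \<in> I \<inter> {- real n..real n} \<longrightarrow> g x - g' x = 0" for n
  proof -
    have "connected (I \<inter> {- real n..real n})" "compact (I \<inter> {- real n..real n})"
      using assms by (auto intro!: is_interval_connected is_interval_Int closed_Int_compact)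
    then obtain \<alpha> \<beta> where ab: "I \<inter> {- real n..real n} = {\<alpha>..\<beta>}"
      using connected_compact_interval_1 by blast
    have sub: "{\<alpha>..\<beta>} \<subseteq> I" using ab by blast
    have int: "set_integrable lborel {a..b} g" "set_integrable lborel {a..b} g'"
      if "{a..b} \<subseteq> I" for a b
      using that I L2 by (auto intro: integrable_on_subinterval)
    have "AE x in lborel. x \<in> {\<alpha>..\<beta>} \<longrightarrow> g x - g' x = 0"
    proof (rule AE_zero_of_interval_integrals)
      show "set_integrable lborel {\<alpha>..\<beta>} (\<lambda>x. g x - g' x)"
        using int[OF sub] by simp
      fix a b assume "\<alpha> \<le> a" "a \<le> b" "b \<le> \<beta>"
      then have *: "a \<le> b" "{a..b} \<subseteq> I" using sub by auto
      have "continuous_on {a..b} f" using f * continuous_on_subset by blast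
      then have "(LINT x:{a..b}|lborel. g x) = f b - f a" "(LINT x:{a..b}|lborel. g' x) = f b - f a"
        using weak_derivative_FTC[OF I _ _ *] wd L2 by metis+
      then show "(LINT x:{a..b}|lborel. g x - g' x) = 0"
        using int[OF *(2)] by simp
    qed
    then show ?thesis using ab by simp
  qed
  then have "AE x in lborel. \<forall>n. x \<in> I \<inter> {- real n..real n} \<longrightarrow> g x - g' x = 0"
    unfolding AE_all_countable by blast
  then have "AE x in lborel. x \<in> I \<longrightarrow> g x = g' x"
  proof eventually_elim
    case (elim x)
    obtain n :: nat where "\<bar>x\<bar> \<le> real n" using real_arch_simple by blast
    then show ?case using elim by (auto simp: abs_le_iff minus_le_iff)
  qed
  then show ?thesis using I by (simp add: AE_restrict_space_iff)
qed

lemma weak_derivative_C1: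
  fixes f :: "real \<Rightarrow> complex"
  assumes I: "I \<in> sets borel"
    and f: "\<And>x. (f has_vector_derivative f' x) (at x)" and f': "continuous_on UNIV f'"
  shows "has_weak_derivative_on I f f'"
  unfolding has_weak_derivative_on_def
proof (intro allI impI)
  fix \<phi> assume "test_function I \<phi>"
  then show "(LINT x:I|lborel. deriv \<phi> x *\<^sub>R f x) = - (LINT x:I|lborel. \<phi> x *\<^sub>R f' x)"
  proof (rule test_functionE)
    fix K assume K: "compact K" "K \<subseteq> interior I" "\<And>x. x \<notin> K \<Longrightarrow> \<phi> x = 0"
      "\<And>x. x \<notin> K \<Longrightarrow> deriv \<phi> x = 0" "continuous_on UNIV \<phi>" "continuous_on UNIV (deriv \<phi>)"
      "\<And>x. (\<phi> has_real_derivative deriv \<phi> x) (at x)"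
    have cf: "continuous_on UNIV f"
      using f by (meson continuous_at_imp_continuous_on has_vector_derivative_continuous)
    have sub: "K \<subseteq> I" using K(2) interior_subset by blast
    obtain R where R: "\<And>x. x \<in> K \<Longrightarrow> \<bar>x\<bar> \<le> R"
      using compact_imp_bounded[OF K(1)] unfolding bounded_iff by auto
    define r where "r = \<bar>R\<bar> + 1"
    have r: "x \<in> {-r..r}" if "x \<in> K" for x using R[OF that] by (auto simp: r_def)
    have rK: "r \<notin> K" "- r \<notin> K" using R[of r] R[of "-r"] by (auto simp: r_def)
    have i1: "integrable lborel (\<lambda>x. deriv \<phi> x *\<^sub>R f x)" and i2: "integrable lborel (\<lambda>x. \<phi> x *\<^sub>R f' x)"
      by (rule integrable_compact_support[OF K(1)]; (simp add: K)?; intro continuous_intros K cf f')+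
    have e: "(LINT x:I|lborel. deriv \<phi> x *\<^sub>R f x) = (\<integral>x. deriv \<phi> x *\<^sub>R f x \<partial>lborel)"
      "(LINT x:I|lborel. \<phi> x *\<^sub>R f' x) = (\<integral>x. \<phi> x *\<^sub>R f' x \<partial>lborel)"
      unfolding set_lebesgue_integral_def
      by (intro Bochner_Integration.integral_cong refl; use K(3,4) sub in \<open>auto simp: indicator_def\<close>)+
    have "(\<integral>x. \<phi> x *\<^sub>R f' x + deriv \<phi> x *\<^sub>R f x \<partial>lborel)
        = (\<integral>x. indicator {-r..r} x *\<^sub>R (\<phi> x *\<^sub>R f' x + deriv \<phi> x *\<^sub>R f x) \<partial>lborel)"
    proof (intro Bochner_Integration.integral_cong refl)
      fix x
      show "\<phi> x *\<^sub>R f' x + deriv \<phi> x *\<^sub>R f x = indicator {-r..r} x *\<^sub>R (\<phi> x *\<^sub>R f' x + deriv \<phi> x *\<^sub>R f x)"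
        using K(3,4)[of x] r[of x] by (cases "x \<in> K") auto
    qed
    also have "\<dots> = \<phi> r *\<^sub>R f r - \<phi> (-r) *\<^sub>R f (-r)"
    proof (rule integral_FTC_Icc)
      show "- r \<le> r" by (simp add: r_def)
      show "((\<lambda>x. \<phi> x *\<^sub>R f x) has_vector_derivative \<phi> x *\<^sub>R f' x + deriv \<phi> x *\<^sub>R f x) (at x within {-r..r})" for x
        by (rule has_vector_derivative_scaleR)
           (use K(7) f in \<open>auto intro: has_vector_derivative_at_within has_field_derivative_at_within\<close>)
      show "continuous_on {-r..r} (\<lambda>x. \<phi> x *\<^sub>R f' x + deriv \<phi> x *\<^sub>R f x)"
        by (intro continuous_intros; use K(5,6) cf f' continuous_on_subset in blast)
    qed
    also have "\<dots> = 0" using K(3) rK by simp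
    finally have "(\<integral>x. \<phi> x *\<^sub>R f' x \<partial>lborel) + (\<integral>x. deriv \<phi> x *\<^sub>R f x \<partial>lborel) = 0"
      using i1 i2 by simp
    then show ?thesis unfolding e by (simp add: eq_neg_iff_add_eq_0 add.commute)
  qed
qed


text \<open>
  The weak derivative of \<open>F\<close> is found by relaxation. Let \<open>a N\<close> be the infimum of
  \<open>\<parallel>H'\<parallel>\<^sup>2\<close> over all \<open>H\<close> that are \<open>1/(N+1)\<close>-close to \<open>F\<close> in \<open>L\<^sup>1(I \<inter> [-N, N])\<close>. These
  constraints are convex and decrease with \<open>N\<close>, and \<open>f n\<close> satisfies each of them eventually, so
  \<open>a N\<close> increases to a limit that is at most \<open>D\<close>. Choose almost optimal \<open>H N\<close>. Midpoints of two
  such functions are still admissible, so the parallelogram identity makes the derivatives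
  \<open>H' N\<close> a Cauchy sequence in \<open>L\<^sup>2\<close>. Their limit is a weak derivative of \<open>F\<close>, because the
  defining identity passes to the limit.
\<close>

lemma weak_derivative_lower_semicontinuous:
  fixes f g :: "nat \<Rightarrow> real \<Rightarrow> complex" and F :: "real \<Rightarrow> complex"
  assumes I: "I \<in> sets borel"
    and f: "\<And>n. L2_on I (f n)" and g: "\<And>n. L2_on I (g n)" and F: "L2_on I F"
    and wd: "\<And>n. has_weak_derivative_on I (f n) (g n)"
    and lim: "\<And>x. x \<in> I \<Longrightarrow> (\<lambda>n. f n x) \<longlonglongrightarrow> F x"
    and bound: "\<And>n x. x \<in> I \<Longrightarrow> cmod (f n x) \<le> \<delta>"
    and d: "\<And>n. (\<integral>x. (cmod (g n x))\<^sup>2 \<partial>leb_on I) \<le> d n" "d \<longlonglongrightarrow> D"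
  obtains G where "L2_on I G" "has_weak_derivative_on I F G" "(\<integral>x. (cmod (G x))\<^sup>2 \<partial>leb_on I) \<le> D"
proof -
  define J where "J N = I \<inter> {- real N..real N}" for N :: nat
  define val where "val H = (\<integral>x. (cmod (H x))\<^sup>2 \<partial>leb_on I)" for H :: "real \<Rightarrow> complex"
  define K where "K N = {(H, H'). L2_on I H \<and> L2_on I H' \<and> has_weak_derivative_on I H H' \<and>
    (LINT x:J N|lborel. cmod (H x - F x)) \<le> 1 / (real N + 1)}" for N
  define a where "a N = Inf ((\<lambda>p. val (snd p)) ` K N)" for N
  have J: "J N \<in> sets borel" "J N \<subseteq> I" "emeasure lborel (J N) < \<infinity>" for N
  proof -
    show "J N \<in> sets borel" "J N \<subseteq> I" using I by (auto simp: J_def)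
    have "emeasure lborel (J N) \<le> emeasure lborel {- real N..real N}"
      by (rule emeasure_mono) (auto simp: J_def)
    also have "\<dots> < \<infinity>" by (simp add: emeasure_lborel_Icc_eq)
    finally show "emeasure lborel (J N) < \<infinity>" .
  qed
  have J_mono: "J N \<subseteq> J M" if "N \<le> M" for N M using that by (auto simp: J_def)
  have int1: "set_integrable lborel (J N) (\<lambda>x. cmod (H x - F x))" if "L2_on I H" for H N
    by (intro set_integrable_norm L2_on_imp_set_integrable[OF I J] L2_on_diff[OF I] that F)
  have int2: "integrable (leb_on I) (\<lambda>x. (cmod (H x))\<^sup>2)" if "L2_on I H" for H
    using that I by (simp add: L2_on_iff)
  have val0: "0 \<le> val H" for H by (simp add: val_def)
  have near: "\<forall>\<^sub>F k in sequentially. (f k, g k) \<in> K N" for N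
  proof -
    have Fb: "cmod (F x) \<le> \<delta>" if "x \<in> I" for x
      by (rule LIMSEQ_le_const2[OF tendsto_norm[OF lim[OF that]]]) (use bound[OF that] in blast)
    have "(\<lambda>k. LINT x:J N|lborel. cmod (f k x - F x)) \<longlonglongrightarrow> (\<integral>x. 0 \<partial>(lborel :: real measure))"
      unfolding set_lebesgue_integral_def
    proof (rule integral_dominated_convergence[where w="\<lambda>x. (2 * \<delta>) * indicator (J N) x"])
      show "integrable lborel (\<lambda>x. (2 * \<delta>) * indicator (J N) x)"
        by (intro integrable_mult_right integrable_real_indicator) (use J in auto)
      show "(\<lambda>x. indicat_real (J N) x *\<^sub>R cmod (f k x - F x)) \<in> borel_measurable lborel" for k
        using int1[OF f] unfolding set_integrable_def by (rule borel_measurable_integrable)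
      show "AE x in lborel. norm (indicat_real (J N) x *\<^sub>R cmod (f k x - F x)) \<le> 2 * \<delta> * indicat_real (J N) x" for k
      proof (rule AE_I2)
        fix x
        show "norm (indicat_real (J N) x *\<^sub>R cmod (f k x - F x)) \<le> 2 * \<delta> * indicat_real (J N) x"
          using norm_triangle_ineq4[of "f k x" "F x"] bound[of x k] Fb[of x] J(2)[of N]
          by (cases "x \<in> J N") auto
      qed
      show "AE x in lborel. (\<lambda>k. indicat_real (J N) x *\<^sub>R cmod (f k x - F x)) \<longlonglongrightarrow> 0"
      proof (rule AE_I2)
        fix x
        have "(\<lambda>k. cmod (f k x - F x)) \<longlonglongrightarrow> 0" if "x \<in> I"
          using lim[OF that] by (simp add: tendsto_norm_zero_iff LIM_zero_iff)
        then show "(\<lambda>k. indicat_real (J N) x *\<^sub>R cmod (f k x - F x)) \<longlonglongrightarrow> 0"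
          using J(2)[of N] by (cases "x \<in> J N") auto
      qed
    qed simp
    then have "\<forall>\<^sub>F k in sequentially. (LINT x:J N|lborel. cmod (f k x - F x)) < 1 / (real N + 1)"
      by (intro order_tendstoD(2)) auto
    then show ?thesis
      by eventually_elim (use f g wd in \<open>auto simp: K_def\<close>)
  qed
  have nonempty: "K N \<noteq> {}" for N
    using eventually_happens[OF near[of N]] by auto
  have bdd: "bdd_below ((\<lambda>p. val (snd p)) ` K N)" for N
    by (rule bdd_belowI[of _ 0]) (use val0 in auto)
  have a_le: "a N \<le> val H'" if "(H, H') \<in> K N" for N H H'
    unfolding a_def by (rule cInf_lower[OF _ bdd]) (use that in force)
  have K_anti: "K M \<subseteq> K N" if "N \<le> M" for N M
  proof -
    have "(LINT x:J N|lborel. cmod (H x - F x)) \<le> 1 / (real N + 1)"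
      if "L2_on I H" "(LINT x:J M|lborel. cmod (H x - F x)) \<le> 1 / (real M + 1)" for H
    proof -
      have "(LINT x:J N|lborel. cmod (H x - F x)) \<le> (LINT x:J M|lborel. cmod (H x - F x))"
        unfolding set_lebesgue_integral_def
        using int1[OF that(1)] J_mono[OF \<open>N \<le> M\<close>]
        by (intro integral_mono) (auto simp: set_integrable_def indicator_def)
      also have "\<dots> \<le> 1 / (real M + 1)" by (rule that(2))
      also have "\<dots> \<le> 1 / (real N + 1)" using \<open>N \<le> M\<close> by (simp add: field_simps)
      finally show ?thesis .
    qed
    then show ?thesis by (auto simp: K_def)
  qed
  have a_mono: "a N \<le> a M" if "N \<le> M" for N M
    unfolding a_def by (rule cInf_superset_mono) (use nonempty bdd K_anti[OF that] in auto)
  have aD: "a N \<le> D" for N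
  proof (rule LIMSEQ_le_const[OF d(2)])
    obtain k0 where k0: "\<And>k. k0 \<le> k \<Longrightarrow> (f k, g k) \<in> K N"
      using near[of N] unfolding eventually_sequentially by blast
    have "a N \<le> d k" if "k0 \<le> k" for k
      using a_le[OF k0[OF that]] d(1)[of k] by (simp add: val_def)
    then show "\<exists>k0. \<forall>k\<ge>k0. a N \<le> d k" by blast
  qed
  obtain A where A: "a \<longlonglongrightarrow> A" "\<And>N. a N \<le> A"
    using incseq_convergent[of a D] a_mono aD by (auto simp: incseq_def)
  have "\<exists>H H'. (H, H') \<in> K N \<and> val H' < a N + 1 / (real N + 1)" for N
    using cInf_lessD[of "(\<lambda>p. val (snd p)) ` K N" "a N + 1 / (real N + 1)"] nonempty[of N]
    by (force simp: a_def)
  then obtain H H' where HK: "\<And>N. (H N, H' N) \<in> K N"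
    and Hval: "\<And>N. val (H' N) < a N + 1 / (real N + 1)"
    by metis
  have L2: "L2_on I (H N)" "L2_on I (H' N)" and Hwd: "has_weak_derivative_on I (H N) (H' N)"
    and Hnear: "(LINT x:J N|lborel. cmod (H N x - F x)) \<le> 1 / (real N + 1)" for N
    using HK[of N] by (auto simp: K_def)
  have mid: "val (\<lambda>x. H' m x - H' n x) \<le> 4 * (A - a N + 1 / (real N + 1))" if "N \<le> m" "N \<le> n" for m n N
  proof -
    let ?h = "\<lambda>x. of_real (1/2) * (H m x + H n x)" and ?h' = "\<lambda>x. of_real (1/2) * (H' m x + H' n x)"
    have near: "(LINT x:J N|lborel. cmod (H k x - F x)) \<le> 1 / (real N + 1)" if "N \<le> k" for k
      using HK[of k] K_anti[OF that] by (auto simp: K_def)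
    have L2h: "L2_on I ?h" "L2_on I ?h'" "has_weak_derivative_on I ?h ?h'"
      by (intro weak_derivative_cmult weak_derivative_add L2_on_cmult L2_on_add I L2 Hwd)+
    have "(LINT x:J N|lborel. cmod (?h x - F x))
        \<le> (LINT x:J N|lborel. 1/2 * cmod (H m x - F x) + 1/2 * cmod (H n x - F x))"
    proof (rule set_integral_mono)
      show "set_integrable lborel (J N) (\<lambda>x. 1/2 * cmod (H m x - F x) + 1/2 * cmod (H n x - F x))"
        by (intro set_integral_add set_integrable_mult_right int1 L2)
      fix x
      have "?h x - F x = of_real (1/2) * ((H m x - F x) + (H n x - F x))"
        by (simp add: field_simps)
      then have "cmod (?h x - F x) = 1/2 * cmod ((H m x - F x) + (H n x - F x))"
        by (simp only: norm_mult norm_of_real)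
      also have "\<dots> \<le> 1/2 * (cmod (H m x - F x) + cmod (H n x - F x))"
        by (intro mult_left_mono norm_triangle_ineq) simp
      finally show "cmod (?h x - F x) \<le> 1/2 * cmod (H m x - F x) + 1/2 * cmod (H n x - F x)"
        by (simp add: algebra_simps)
    qed (rule int1[OF L2h(1)])
    also have "\<dots> = 1/2 * (LINT x:J N|lborel. cmod (H m x - F x)) + 1/2 * (LINT x:J N|lborel. cmod (H n x - F x))"
      by (subst set_integral_add(2)) (auto intro!: set_integrable_mult_right int1 L2)
    also have "\<dots> \<le> 1 / (real N + 1)" using near[OF that(1)] near[OF that(2)] by linarith
    finally have "(?h, ?h') \<in> K N" using L2h by (simp add: K_def)
    then have "a N \<le> val ?h'" by (rule a_le)
    moreover have "val (\<lambda>x. H' m x - H' n x) = 2 * val (H' m) + 2 * val (H' n) - 4 * val ?h'"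
    proof -
      have *: "(cmod (u - v))\<^sup>2 = 2 * (cmod u)\<^sup>2 + 2 * (cmod v)\<^sup>2 - 4 * (cmod (of_real (1/2) * (u + v)))\<^sup>2"
        for u v :: complex
        unfolding cmod_power2 by (simp add: power2_eq_square field_simps)
      show ?thesis
        unfolding val_def
        by (subst *) (use int2[OF L2(2)] int2[OF L2h(2)] in simp)
    qed
    ultimately have "val (\<lambda>x. H' m x - H' n x) \<le> 2 * val (H' m) + 2 * val (H' n) - 4 * a N" by linarith
    moreover have "1 / (real k + 1) \<le> 1 / (real N + 1)" if "N \<le> k" for k
      using that by (simp add: field_simps)
    ultimately show ?thesis
      using Hval[of m] Hval[of n] A(2)[of m] A(2)[of n] that by (smt (verit))
  qed
  have inv0: "(\<lambda>N. 1 / (real N + 1)) \<longlonglongrightarrow> 0"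
    using LIMSEQ_inverse_real_of_nat by (simp add: inverse_eq_divide add.commute)
  obtain G r where G: "G \<in> borel_measurable (leb_on I)" "integrable (leb_on I) (\<lambda>x. (cmod (G x))\<^sup>2)"
    and r: "strict_mono (r :: nat \<Rightarrow> nat)" "AE x in leb_on I. (\<lambda>k. H' (r k) x) \<longlonglongrightarrow> G x"
    and conv: "(\<lambda>n. \<integral>x. (cmod (H' n x - G x))\<^sup>2 \<partial>leb_on I) \<longlonglongrightarrow> 0"
  proof (rule L2_complete[of H' "leb_on I"])
    show "H' n \<in> borel_measurable (leb_on I)" "integrable (leb_on I) (\<lambda>x. (cmod (H' n x))\<^sup>2)" for n
      using L2(2)[of n] I by (auto simp: L2_on_iff)
    fix e :: real assume "0 < e"
    have "(\<lambda>N. 4 * (A - a N + 1 / (real N + 1))) \<longlonglongrightarrow> 4 * (A - A + 0)"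
      by (intro tendsto_intros A inv0)
    then have "\<forall>\<^sub>F N in sequentially. 4 * (A - a N + 1 / (real N + 1)) < e"
      using \<open>0 < e\<close> by (intro order_tendstoD(2)) auto
    then obtain N where "4 * (A - a N + 1 / (real N + 1)) < e"
      by (auto simp: eventually_sequentially)
    then have "val (\<lambda>x. H' m x - H' n x) \<le> e" if "N \<le> m" "N \<le> n" for m n
      using mid[OF that] by linarith
    then show "\<exists>N. \<forall>m\<ge>N. \<forall>n\<ge>N. (\<integral>x. (cmod (H' m x - H' n x))\<^sup>2 \<partial>leb_on I) \<le> e"
      unfolding val_def by blast
  qed blast
  have L2G: "L2_on I G" using G I by (simp add: L2_on_iff)
  have "val G \<le> D"
    unfolding val_def
  proof (rule conjunct2[OF fatou_bound[where h="\<lambda>k x. (cmod (H' (r k) x))\<^sup>2" and b="\<lambda>k. D + 1 / (real k + 1)"]])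
    show "(\<integral>x. (cmod (H' (r k) x))\<^sup>2 \<partial>leb_on I) \<le> D + 1 / (real k + 1)" for k
    proof -
      have "1 / (real (r k) + 1) \<le> 1 / (real k + 1)"
        using seq_suble[OF r(1), of k] by (simp add: field_simps)
      then show ?thesis using Hval[of "r k"] aD[of "r k"] by (simp add: val_def)
    qed
    show "AE x in leb_on I. (\<lambda>k. (cmod (H' (r k) x))\<^sup>2) \<longlonglongrightarrow> (cmod (G x))\<^sup>2"
      using r(2) by eventually_elim (intro tendsto_intros)
    show "(\<lambda>k. D + 1 / (real k + 1)) \<longlonglongrightarrow> D"
      using tendsto_add[OF tendsto_const inv0] by simp
  qed (use int2[OF L2(2)] G in auto)
  moreover have "has_weak_derivative_on I F G"
    unfolding has_weak_derivative_on_def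
  proof (intro allI impI)
    fix \<phi> assume \<phi>: "test_function I \<phi>"
    then show "(LINT x:I|lborel. deriv \<phi> x *\<^sub>R F x) = - (LINT x:I|lborel. \<phi> x *\<^sub>R G x)"
    proof (rule test_functionE)
      fix K assume K: "compact K" "K \<subseteq> interior I" "\<And>x. x \<notin> K \<Longrightarrow> \<phi> x = 0"
        "\<And>x. x \<notin> K \<Longrightarrow> deriv \<phi> x = 0" "continuous_on UNIV \<phi>" "continuous_on UNIV (deriv \<phi>)"
      obtain B where B: "\<And>x. x \<in> K \<Longrightarrow> \<bar>deriv \<phi> x\<bar> \<le> B"
        using compact_imp_bounded[OF compact_continuous_image[OF continuous_on_subset[OF K(6)] K(1)]]
        unfolding bounded_iff by auto
      obtain R where R: "\<And>x. x \<in> K \<Longrightarrow> \<bar>x\<bar> \<le> R"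
        using compact_imp_bounded[OF K(1)] unfolding bounded_iff by auto
      define B' where "B' = \<bar>B\<bar>"
      have KJ: "x \<in> J n" if "x \<in> K" "R \<le> real n" for x n
        using that R[OF that(1)] K(2) interior_subset[of I] by (auto simp: J_def)
      have lim1: "(\<lambda>n. LINT x:I|lborel. deriv \<phi> x *\<^sub>R H n x) \<longlonglongrightarrow> (LINT x:I|lborel. deriv \<phi> x *\<^sub>R F x)"
      proof (rule LIM_zero_cancel, rule Lim_null_comparison)
        show "(\<lambda>n. B' * (1 / (real n + 1))) \<longlonglongrightarrow> 0"
          using tendsto_mult_right_zero[OF inv0] .
        obtain n0 :: nat where n0: "R \<le> real n0" using real_arch_simple by blast
        show "\<forall>\<^sub>F n in sequentially. cmod ((LINT x:I|lborel. deriv \<phi> x *\<^sub>R H n x) - (LINT x:I|lborel. deriv \<phi> x *\<^sub>R F x)) \<le> B' * (1 / (real n + 1))"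
          using eventually_ge_at_top[of n0]
        proof eventually_elim
          case (elim n)
          have ti: "set_integrable lborel I (\<lambda>x. deriv \<phi> x *\<^sub>R H n x)" "set_integrable lborel I (\<lambda>x. deriv \<phi> x *\<^sub>R F x)"
            using test_function_integrable(2)[OF I \<phi>] L2(1) F I by (simp_all add: set_integrable_eq)
          then have "(LINT x:I|lborel. deriv \<phi> x *\<^sub>R H n x) - (LINT x:I|lborel. deriv \<phi> x *\<^sub>R F x)
              = (LINT x:I|lborel. deriv \<phi> x *\<^sub>R H n x - deriv \<phi> x *\<^sub>R F x)"
            by simp
          also have "cmod \<dots> \<le> (\<integral>x. B' * (indicator (J n) x *\<^sub>R cmod (H n x - F x)) \<partial>lborel)"
            unfolding set_lebesgue_integral_def
          proof (rule Bochner_Integration.integral_norm_bound_integral)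
            show "integrable lborel (\<lambda>x. indicat_real I x *\<^sub>R (deriv \<phi> x *\<^sub>R H n x - deriv \<phi> x *\<^sub>R F x))"
              using set_integral_diff(1)[OF ti] by (simp add: set_integrable_def)
            show "integrable lborel (\<lambda>x. B' * (indicator (J n) x *\<^sub>R cmod (H n x - F x)))"
              using int1[OF L2(1)] unfolding set_integrable_def by (rule integrable_mult_right)
            fix x
            show "cmod (indicat_real I x *\<^sub>R (deriv \<phi> x *\<^sub>R H n x - deriv \<phi> x *\<^sub>R F x))
                \<le> B' * (indicator (J n) x *\<^sub>R cmod (H n x - F x))"
            proof (cases "x \<in> K")
              case True
              then have "x \<in> J n" "x \<in> I" using KJ[of x n] n0 elim J(2)[of n] by auto
              then show ?thesis
                using B[OF True] by (auto simp: B'_def simp flip: scaleR_diff_right intro!: mult_right_mono)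
            next
              case False
              then show ?thesis using K(4)[of x] by (simp add: B'_def)
            qed
          qed
          also have "\<dots> = B' * (LINT x:J n|lborel. cmod (H n x - F x))"
            by (simp add: set_lebesgue_integral_def)
          also have "\<dots> \<le> B' * (1 / (real n + 1))"
            by (intro mult_left_mono Hnear) (simp add: B'_def)
          finally show ?case .
        qed
      qed
      have lim2: "(\<lambda>n. LINT x:I|lborel. \<phi> x *\<^sub>R H' n x) \<longlonglongrightarrow> (LINT x:I|lborel. \<phi> x *\<^sub>R G x)"
      proof (rule LIM_zero_cancel, rule Lim_null_comparison)
        let ?c = "\<integral>x. (\<phi> x)\<^sup>2 \<partial>leb_on I"
        have "(\<lambda>n. sqrt (?c * val (\<lambda>x. H' n x - G x))) \<longlonglongrightarrow> sqrt (?c * 0)"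
          using conv unfolding val_def by (intro tendsto_intros)
        then show "(\<lambda>n. sqrt (?c * val (\<lambda>x. H' n x - G x))) \<longlonglongrightarrow> 0" by simp
        show "\<forall>\<^sub>F n in sequentially. cmod ((LINT x:I|lborel. \<phi> x *\<^sub>R H' n x) - (LINT x:I|lborel. \<phi> x *\<^sub>R G x)) \<le> sqrt (?c * val (\<lambda>x. H' n x - G x))"
        proof (rule always_eventually, rule allI, rule real_le_rsqrt)
          fix n
          have "(LINT x:I|lborel. \<phi> x *\<^sub>R H' n x) - (LINT x:I|lborel. \<phi> x *\<^sub>R G x)
            = (\<integral>x. \<phi> x *\<^sub>R (H' n x - G x) \<partial>leb_on I)"
            using test_function_integrable(1)[OF I \<phi>] L2(2) L2G I by (simp add: set_lint_eq scaleR_diff_right)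
          also have "(cmod \<dots>)\<^sup>2 \<le> ?c * val (\<lambda>x. H' n x - G x)"
            unfolding val_def
          proof (rule Cauchy_Schwarz_scaleR)
            show "\<phi> \<in> borel_measurable (leb_on I)" by (rule measurable_leb_on_continuous[OF K(5)])
            show "integrable (leb_on I) (\<lambda>x. (\<phi> x)\<^sup>2)"
              by (rule square_integrable_compact_support[OF I K(1) K(3,5)])
          qed (use L2_on_diff[OF I L2(2)[of n] L2G] I in \<open>auto simp: L2_on_iff\<close>)
          finally show "(cmod ((LINT x:I|lborel. \<phi> x *\<^sub>R H' n x) - (LINT x:I|lborel. \<phi> x *\<^sub>R G x)))\<^sup>2
            \<le> ?c * val (\<lambda>x. H' n x - G x)" .
        qed
      qed
      have "(\<lambda>n. LINT x:I|lborel. deriv \<phi> x *\<^sub>R H n x) = (\<lambda>n. - (LINT x:I|lborel. \<phi> x *\<^sub>R H' n x))"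
        using Hwd \<phi> by (simp add: has_weak_derivative_on_def)
      then show ?thesis
        using lim1 tendsto_minus[OF lim2] LIMSEQ_unique by metis
    qed
  qed
  ultimately show thesis using that[OF L2G] by (simp add: val_def)
qed

text \<open>
  The fundamental theorem and the Cauchy-Schwarz inequality on \<open>[a, b]\<close>.
\<close>

lemma weak_derivative_Hoelder:
  assumes I: "I \<in> sets borel" and wd: "has_weak_derivative_on I f g" and g: "L2_on I g"
    and ab: "a \<le> b" "{a..b} \<subseteq> I" and f: "continuous_on I f"
  shows "(cmod (f b - f a))\<^sup>2 \<le> (b - a) * (\<integral>x. (cmod (g x))\<^sup>2 \<partial>leb_on I)"
proof -
  let ?M = "leb_on {a..b}"
  have g2: "set_integrable lborel I (\<lambda>x. (cmod (g x))\<^sup>2)" using g by (simp add: L2_on_def)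
  have g2': "set_integrable lborel {a..b} (\<lambda>x. (cmod (g x))\<^sup>2)"
    by (rule set_integrable_subset[OF g2]) (use ab in auto)
  have one: "(\<integral>x. 1\<^sup>2 \<partial>?M) = b - a" "integrable ?M (\<lambda>x. 1\<^sup>2 :: real)"
    using ab(1)
    by (simp_all add: measure_restrict_space flip: set_integrable_eq)
       (simp add: set_integrable_def)
  have "f b - f a = (LINT x:{a..b}|lborel. g x)"
    by (rule weak_derivative_FTC[OF I wd g ab]) (rule continuous_on_subset[OF f ab(2)])
  also have "\<dots> = (\<integral>x. 1 *\<^sub>R g x \<partial>?M)" by (simp add: set_lint_eq)
  also have "(cmod \<dots>)\<^sup>2 \<le> (\<integral>x. 1\<^sup>2 \<partial>?M) * (\<integral>x. (cmod (g x))\<^sup>2 \<partial>?M)"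
  proof (rule Cauchy_Schwarz_scaleR)
    have "set_borel_measurable lborel {a..b} g"
      using integrable_on_subinterval[OF I ab(2) g]
      unfolding set_integrable_def set_borel_measurable_def by (rule borel_measurable_integrable)
    then show "g \<in> borel_measurable ?M"
      by (simp add: set_borel_measurable_def borel_measurable_restrict_space_iff)
    show "integrable ?M (\<lambda>x. (cmod (g x))\<^sup>2)" using g2' by (simp add: set_integrable_eq)
  qed (use one(2) in auto)
  also have "(\<integral>x. (cmod (g x))\<^sup>2 \<partial>?M) \<le> (\<integral>x. (cmod (g x))\<^sup>2 \<partial>leb_on I)"
  proof -
    have "(LINT x:{a..b}|lborel. (cmod (g x))\<^sup>2) \<le> (LINT x:I|lborel. (cmod (g x))\<^sup>2)"
      unfolding set_lebesgue_integral_def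
      using g2 g2' ab(2) by (intro integral_mono) (auto simp: set_integrable_def indicator_def)
    then show ?thesis using I by (simp add: set_lint_eq)
  qed
  finally show ?thesis using one ab(1) by (simp add: mult_left_mono)
qed

text \<open>
  The inequality \<open>\<bar>f x\<bar>\<^sup>2 \<le> 2 \<bar>f y\<bar>\<^sup>2 + 2 (b - a) \<parallel>g\<parallel>\<^sup>2\<close> averaged over \<open>y \<in> [a, b]\<close>. The length
  \<open>b - a\<close> stays free: choosing it well replaces an interpolation inequality.
\<close>

lemma local_sup_bound:
  assumes I: "I \<in> sets borel" and wd: "has_weak_derivative_on I f g" and L2: "L2_on I f" "L2_on I g"
    and ab: "a < b" "{a..b} \<subseteq> I" and f: "continuous_on I f" and x: "x \<in> {a..b}"
  shows "(cmod (f x))\<^sup>2 \<le> 2 / (b - a) * (\<integral>x. (cmod (f x))\<^sup>2 \<partial>leb_on I)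
    + 2 * (b - a) * (\<integral>x. (cmod (g x))\<^sup>2 \<partial>leb_on I)"
proof -
  let ?D = "\<integral>x. (cmod (g x))\<^sup>2 \<partial>leb_on I" and ?m = "\<integral>x. (cmod (f x))\<^sup>2 \<partial>leb_on I"
  have D0: "0 \<le> ?D" by simp
  have pt: "(cmod (f x))\<^sup>2 \<le> 2 * (cmod (f y))\<^sup>2 + 2 * ((b - a) * ?D)" if y: "y \<in> {a..b}" for y
  proof -
    have "(cmod (f x - f y))\<^sup>2 \<le> (b - a) * ?D"
    proof (cases "x \<le> y")
      case True
      then have "(cmod (f y - f x))\<^sup>2 \<le> (y - x) * ?D"
        by (intro weak_derivative_Hoelder[OF I wd L2(2) _ _ f]) (use x y ab in auto)
      also have "\<dots> \<le> (b - a) * ?D" using x y D0 by (intro mult_right_mono) auto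
      finally show ?thesis by (simp add: norm_minus_commute)
    next
      case False
      then have "(cmod (f x - f y))\<^sup>2 \<le> (x - y) * ?D"
        by (intro weak_derivative_Hoelder[OF I wd L2(2) _ _ f]) (use x y ab in auto)
      also have "\<dots> \<le> (b - a) * ?D" using x y D0 by (intro mult_right_mono) auto
      finally show ?thesis .
    qed
    then show ?thesis using cmod_add_sq_le[of "f y" "f x - f y"] by simp
  qed
  have f2: "set_integrable lborel I (\<lambda>x. (cmod (f x))\<^sup>2)" using L2 by (simp add: L2_on_def)
  have f2': "set_integrable lborel {a..b} (\<lambda>x. (cmod (f x))\<^sup>2)"
    by (rule set_integrable_subset[OF f2]) (use ab in auto)
  have const: "set_integrable lborel {a..b} (\<lambda>_. c :: real)" "(LINT _:{a..b}|lborel. c) = (b - a) * c" for c :: real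
    using ab(1) by (auto simp: set_integrable_def set_lebesgue_integral_def emeasure_lborel_Icc_eq)
  have "(b - a) * (cmod (f x))\<^sup>2 = (LINT y:{a..b}|lborel. (cmod (f x))\<^sup>2)" by (simp add: const)
  also have "\<dots> \<le> (LINT y:{a..b}|lborel. 2 * (cmod (f y))\<^sup>2 + 2 * ((b - a) * ?D))"
    by (intro set_integral_mono const set_integral_add set_integrable_mult_right f2' pt)
  also have "\<dots> = 2 * (LINT y:{a..b}|lborel. (cmod (f y))\<^sup>2) + (b - a) * (2 * ((b - a) * ?D))"
    by (subst set_integral_add(2)) (auto intro!: set_integrable_mult_right f2' simp: const)
  also have "(LINT y:{a..b}|lborel. (cmod (f y))\<^sup>2) \<le> (LINT y:I|lborel. (cmod (f y))\<^sup>2)"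
      unfolding set_lebesgue_integral_def
      using f2 f2' ab(2) by (intro integral_mono) (auto simp: set_integrable_def indicator_def)
  also have "(LINT y:I|lborel. (cmod (f y))\<^sup>2) = ?m" using I by (simp add: set_lint_eq)
  also have "2 * ?m + (b - a) * (2 * ((b - a) * ?D)) = (b - a) * (2 / (b - a) * ?m + 2 * (b - a) * ?D)"
    using ab(1) by (simp add: distrib_left)
  finally have "(b - a) * (cmod (f x))\<^sup>2 \<le> (b - a) * (2 / (b - a) * ?m + 2 * (b - a) * ?D)"
    by simp
  then show ?thesis using ab(1) by simp
qed

lemma H1_on_weak_deriv:
  assumes "H1_on I f"
  shows "L2_on I f" "L2_on I (weak_deriv I f)" "has_weak_derivative_on I f (weak_deriv I f)"
  using assms someI_ex[of "\<lambda>g. L2_on I g \<and> has_weak_derivative_on I f g"]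
  by (auto simp: H1_on_def weak_deriv_def)

lemma integral_weak_deriv:
  assumes "closed I" "is_interval I" and f: "continuous_on I f" "L2_on I f"
    and g: "L2_on I g" "has_weak_derivative_on I f g"
  shows "H1_on I f"
    and "(\<integral>x. (cmod (weak_deriv I f x))\<^sup>2 \<partial>leb_on I) = (\<integral>x. (cmod (g x))\<^sup>2 \<partial>leb_on I)"
proof -
  have I: "I \<in> sets borel" using assms by auto
  show "H1_on I f" using f g by (auto simp: H1_on_def)
  then have wd: "L2_on I (weak_deriv I f)" "has_weak_derivative_on I f (weak_deriv I f)"
    by (rule H1_on_weak_deriv)+
  have "AE x in leb_on I. weak_deriv I f x = g x"
    by (rule weak_derivative_unique[OF assms(1,2) f(1) wd(2) g(2) wd(1) g(1)])
  then show "(\<integral>x. (cmod (weak_deriv I f x))\<^sup>2 \<partial>leb_on I) = (\<integral>x. (cmod (g x))\<^sup>2 \<partial>leb_on I)"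
    using wd(1) g(1) I by (intro integral_cong_AE) (auto simp: L2_on_iff)
qed

section \<open>The energy on a metric graph\<close>

definition mass :: "('v, 'e) pre_metric_graph \<Rightarrow> ('e \<Rightarrow> real \<Rightarrow> complex) \<Rightarrow> real" where
  "mass G u = (\<Sum>e\<in>edges G. \<integral>x. (cmod (u e x))\<^sup>2 \<partial>leb_on (edge_interval G e))"

definition kinetic :: "('v, 'e) pre_metric_graph \<Rightarrow> ('e \<Rightarrow> real \<Rightarrow> complex) \<Rightarrow> real" where
  "kinetic G u = (\<Sum>e\<in>edges G.
     \<integral>x. (cmod (weak_deriv (edge_interval G e) (u e) x))\<^sup>2 \<partial>leb_on (edge_interval G e))"

definition power_term :: "('v, 'e) pre_metric_graph \<Rightarrow> real \<Rightarrow> ('e \<Rightarrow> real \<Rightarrow> complex) \<Rightarrow> real" where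
  "power_term G p u = (\<Sum>e\<in>edges G. \<integral>x. cmod (u e x) powr p \<partial>leb_on (edge_interval G e))"

definition potential ::
    "('v, 'e) pre_metric_graph \<Rightarrow> ('e \<Rightarrow> real \<Rightarrow> real) \<Rightarrow> ('e \<Rightarrow> real \<Rightarrow> complex) \<Rightarrow> real" where
  "potential G w u = (\<Sum>e\<in>bounded_edges G. \<integral>x. w e x * (cmod (u e x))\<^sup>2 \<partial>leb_on (edge_interval G e))"

context metric_graph
begin

lemma edge_cases [consumes 1, case_names bounded halfline]:
  assumes "e \<in> edges G"
  obtains l where "e \<in> bounded_edges G" "0 < l" "len G e = ereal l" "edge_interval G e = {0..l}"
  | "e \<in> halflines G" "edge_interval G e = {0..}"
proof (cases "len G e")
  case (real l)
  then show thesis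
    using len_pos[OF assms] assms
    by (intro that(1)[of l]) (auto simp: bounded_edges_def edge_interval_def)
next
  case PInf
  then show thesis
    using assms by (intro that(2)) (auto simp: halflines_def edge_interval_def)
qed (use len_pos[OF assms] in auto)

lemma edge_interval_facts:
  assumes "e \<in> edges G"
  shows "closed (edge_interval G e)" "is_interval (edge_interval G e)"
    "edge_interval G e \<in> sets borel"
  using assms by (cases rule: edge_cases; auto simp: is_interval_cc is_interval_ci)+

lemma bounded_edges_subset: "bounded_edges G \<subseteq> edges G" "finite (bounded_edges G)"
  using finite_edges by (auto simp: bounded_edges_def)

lemma energy_eq:
  "energy G p w u = 1 / 2 * kinetic G u - 1 / p * power_term G p u - 1 / 2 * potential G w u"
proof -
  have "(\<Sum>e\<in>bounded_edges G. LINT x:edge_interval G e|lborel. w e x * (cmod (u e x))\<^sup>2) = potential G w u"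
    unfolding potential_def
    by (intro sum.cong refl set_lint_eq edge_interval_facts) (use bounded_edges_subset in auto)
  then show ?thesis
    by (simp add: energy_def kinetic_def power_term_def set_lint_eq edge_interval_facts cong: sum.cong)
qed

lemma H1_mass_iff: "u \<in> H1_mass G \<mu> \<longleftrightarrow> u \<in> H1_graph G \<and> mass G u = \<mu>"
  by (simp add: H1_mass_def mass_def set_lint_eq edge_interval_facts cong: sum.cong)

lemma H1_graphD:
  assumes "u \<in> H1_graph G" "e \<in> edges G"
  shows "continuous_on (edge_interval G e) (u e)" "L2_on (edge_interval G e) (u e)"
    "L2_on (edge_interval G e) (weak_deriv (edge_interval G e) (u e))"
    "has_weak_derivative_on (edge_interval G e) (u e) (weak_deriv (edge_interval G e) (u e))"
  using assms H1_on_weak_deriv by (auto simp: H1_graph_def continuous_on_graph_def)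

lemma mass_nonneg: "0 \<le> mass G u" and kinetic_nonneg: "0 \<le> kinetic G u"
  and power_term_nonneg: "0 \<le> power_term G p u"
  by (simp_all add: mass_def kinetic_def power_term_def sum_nonneg)

lemma edge_mass_le: "e \<in> edges G \<Longrightarrow> (\<integral>x. (cmod (u e x))\<^sup>2 \<partial>leb_on (edge_interval G e)) \<le> mass G u"
  unfolding mass_def
  by (rule member_le_sum[where f="\<lambda>e. \<integral>x. (cmod (u e x))\<^sup>2 \<partial>leb_on (edge_interval G e)"])
     (use finite_edges in auto)

lemma edge_kinetic_le:
  "e \<in> edges G \<Longrightarrow> (\<integral>x. (cmod (weak_deriv (edge_interval G e) (u e) x))\<^sup>2 \<partial>leb_on (edge_interval G e)) \<le> kinetic G u"
  unfolding kinetic_def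
  by (rule member_le_sum[where f="\<lambda>e. \<integral>x. (cmod (weak_deriv (edge_interval G e) (u e) x))\<^sup>2 \<partial>leb_on (edge_interval G e)"])
     (use finite_edges in auto)

lemma scale_H1:
  assumes u: "u \<in> H1_graph G"
  shows "(\<lambda>e x. of_real c * u e x) \<in> H1_graph G"
    and "kinetic G (\<lambda>e x. of_real c * u e x) = c\<^sup>2 * kinetic G u"
proof -
  have *: "H1_on I (\<lambda>x. of_real c * u e x) \<and>
      (\<integral>x. (cmod (weak_deriv I (\<lambda>x. of_real c * u e x) x))\<^sup>2 \<partial>leb_on I)
        = c\<^sup>2 * (\<integral>x. (cmod (weak_deriv I (u e) x))\<^sup>2 \<partial>leb_on I)"
    if e: "e \<in> edges G" and I: "I = edge_interval G e" for e I
  proof -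
    let ?g = "\<lambda>x. of_real c * weak_deriv I (u e) x"
    note facts = edge_interval_facts[OF e] H1_graphD[OF u e]
    have L2: "L2_on I (\<lambda>x. of_real c * u e x)" "L2_on I ?g"
      "has_weak_derivative_on I (\<lambda>x. of_real c * u e x) ?g"
      unfolding I by (intro L2_on_cmult weak_derivative_cmult facts)+
    have "continuous_on I (\<lambda>x. of_real c * u e x)"
      unfolding I by (intro continuous_intros facts)
    note wd = integral_weak_deriv[OF _ _ this L2]
    show ?thesis
      using wd facts by (auto simp: I norm_mult power_mult_distrib)
  qed
  show "kinetic G (\<lambda>e x. of_real c * u e x) = c\<^sup>2 * kinetic G u"
    unfolding kinetic_def sum_distrib_left by (rule sum.cong) (use * in auto)
  have "continuous_on_graph G u" using u by (simp add: H1_graph_def)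
  then obtain k where k: "\<forall>e\<in>edges G. u e 0 = k (origin G e)"
    "\<forall>e\<in>bounded_edges G. u e (real_of_ereal (len G e)) = k (terminus G e)"
    unfolding continuous_on_graph_def by blast
  have "continuous_on_graph G (\<lambda>e x. of_real c * u e x)"
    unfolding continuous_on_graph_def
  proof (intro conjI ballI)
    show "continuous_on (edge_interval G e) (\<lambda>x. of_real c * u e x)" if "e \<in> edges G" for e
      by (intro continuous_intros H1_graphD[OF u that])
    show "\<exists>k. (\<forall>e\<in>edges G. of_real c * u e 0 = k (origin G e)) \<and>
        (\<forall>e\<in>bounded_edges G. of_real c * u e (real_of_ereal (len G e)) = k (terminus G e))"
      by (intro exI[of _ "\<lambda>v. of_real c * k v"]) (use k in simp)
  qed
  then show "(\<lambda>e x. of_real c * u e x) \<in> H1_graph G"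
    using * by (simp add: H1_graph_def)
qed

lemma scale_terms:
  shows "mass G (\<lambda>e x. of_real c * u e x) = c\<^sup>2 * mass G u"
    and "potential G w (\<lambda>e x. of_real c * u e x) = c\<^sup>2 * potential G w u"
    and "power_term G p (\<lambda>e x. of_real c * u e x) = \<bar>c\<bar> powr p * power_term G p u"
proof -
  show "mass G (\<lambda>e x. of_real c * u e x) = c\<^sup>2 * mass G u"
    and "power_term G p (\<lambda>e x. of_real c * u e x) = \<bar>c\<bar> powr p * power_term G p u"
    by (simp_all add: mass_def power_term_def norm_mult power_mult_distrib powr_mult sum_distrib_left)
  have "w e x * (cmod (of_real c * u e x))\<^sup>2 = c\<^sup>2 * (w e x * (cmod (u e x))\<^sup>2)" for e x
    by (simp add: norm_mult power_mult_distrib)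
  then show "potential G w (\<lambda>e x. of_real c * u e x) = c\<^sup>2 * potential G w u"
    unfolding potential_def sum_distrib_left by (simp only: integral_mult_right_zero)
qed

text \<open>
  Under multiplication by \<open>c \<ge> 1\<close> the quadratic terms scale by \<open>c\<^sup>2\<close>, but the power term,
  which enters with a negative sign, by the larger factor \<open>c\<^sup>p\<close>.
\<close>

lemma energy_scale_le:
  assumes "u \<in> H1_graph G" "1 \<le> c" "2 \<le> p"
  shows "energy G p w (\<lambda>e x. of_real c * u e x) \<le> c\<^sup>2 * energy G p w u"
proof -
  have "c\<^sup>2 = c powr 2" using assms(2) by simp
  also have "\<dots> \<le> c powr p" using assms(2,3) by (intro powr_mono) auto
  finally have "1 / p * (c\<^sup>2 * power_term G p u) \<le> 1 / p * (c powr p * power_term G p u)"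
    using assms(3) by (intro mult_left_mono mult_right_mono power_term_nonneg) auto
  then show ?thesis
    using assms(2) by (simp add: energy_eq scale_H1[OF assms(1)] scale_terms algebra_simps)
qed

text \<open>
  Half the length of the shortest bounded edge is admissible: then one of \<open>[x, x + s]\<close> and
  \<open>[x - s, x]\<close> fits into the edge. The bound \<open>1\<close> covers graphs without bounded edges.
\<close>

lemma obtain_subinterval_length:
  obtains s\<^sub>0 where "0 < s\<^sub>0"
    "\<And>e x s. e \<in> edges G \<Longrightarrow> x \<in> edge_interval G e \<Longrightarrow> 0 < s \<Longrightarrow> s \<le> s\<^sub>0 \<Longrightarrow>
      \<exists>a. x \<in> {a..a + s} \<and> {a..a + s} \<subseteq> edge_interval G e"
proof -
  define L where "L = insert 1 ((\<lambda>e. real_of_ereal (len G e) / 2) ` bounded_edges G)"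
  have fin: "finite L" "L \<noteq> {}" using bounded_edges_subset by (auto simp: L_def)
  have pos: "0 < r" if "r \<in> L" for r
    using that
  proof (auto simp: L_def)
    fix e assume "e \<in> bounded_edges G"
    then show "0 < real_of_ereal (len G e)"
      using len_pos[of e] by (cases "len G e") (auto simp: bounded_edges_def)
  qed
  show thesis
  proof (rule that[of "Min L"])
    show "0 < Min L" using fin pos by simp
    fix e x s assume e: "e \<in> edges G" "x \<in> edge_interval G e" and s: "0 < s" "s \<le> Min L"
    show "\<exists>a. x \<in> {a..a + s} \<and> {a..a + s} \<subseteq> edge_interval G e"
      using e(1)
    proof (cases rule: edge_cases)
      case (bounded l)
      then have "l / 2 \<in> L" by (force simp: L_def)
      then have "s \<le> l / 2" using s(2) fin by (meson Min_le order_trans)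
      then have "{x..x + s} \<subseteq> edge_interval G e \<or> {x - s..x - s + s} \<subseteq> edge_interval G e"
        using e(2) bounded(4) s(1) by auto
      then show ?thesis using s(1)
        by (elim disjE) (rule exI[of _ x], simp, rule exI[of _ "x - s"], simp)
    next
      case halfline
      then show ?thesis using e(2) s(1) by (intro exI[of _ x]) auto
    qed
  qed
qed

text \<open>
  A form of the inequality \<open>\<parallel>u\<parallel>\<^sub>\<infinity>\<^sup>2 \<le> C \<parallel>u\<parallel> \<parallel>u'\<parallel>\<close> that also holds on compact graphs, where constants rule
  out the homogeneous version: \<open>D\<close> bounds \<open>\<parallel>u'\<parallel>\<close> and is at least \<open>1\<close>. It is \<open>local_sup_bound\<close> on an
  interval of length \<open>s\<^sub>0 \<parallel>u\<parallel> / D\<close>, which balances the two terms there.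
\<close>

lemma sup_bound:
  obtains C where "1 \<le> C"
    "\<And>u D e x. u \<in> H1_graph G \<Longrightarrow> 0 < mass G u \<Longrightarrow> mass G u \<le> 1 \<Longrightarrow> 1 \<le> D \<Longrightarrow> kinetic G u \<le> D\<^sup>2 \<Longrightarrow>
      e \<in> edges G \<Longrightarrow> x \<in> edge_interval G e \<Longrightarrow> (cmod (u e x))\<^sup>2 \<le> C * sqrt (mass G u) * D"
proof -
  obtain s\<^sub>0 where s0: "0 < s\<^sub>0"
    "\<And>e x s. e \<in> edges G \<Longrightarrow> x \<in> edge_interval G e \<Longrightarrow> 0 < s \<Longrightarrow> s \<le> s\<^sub>0 \<Longrightarrow>
      \<exists>a. x \<in> {a..a + s} \<and> {a..a + s} \<subseteq> edge_interval G e"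
    using obtain_subinterval_length by blast
  show thesis
  proof (rule that[of "max 1 (2 / s\<^sub>0 + 2 * s\<^sub>0)"])
    fix u :: "'e \<Rightarrow> real \<Rightarrow> complex" and D :: real and e x
    assume u: "u \<in> H1_graph G" "0 < mass G u" "mass G u \<le> 1" "1 \<le> D" "kinetic G u \<le> D\<^sup>2"
      and e: "e \<in> edges G" "x \<in> edge_interval G e"
    define m where "m = sqrt (mass G u)"
    have m: "0 < m" "m \<le> 1" "mass G u = m * m" using u by (auto simp: m_def)
    define s where "s = s\<^sub>0 * m / D"
    have "s\<^sub>0 * m \<le> s\<^sub>0 * D" using m u s0(1) by (intro mult_left_mono) auto
    then have s: "0 < s" "s \<le> s\<^sub>0"
      using m s0(1) u by (auto simp: s_def field_simps)
    obtain a where a: "x \<in> {a..a + s}" "{a..a + s} \<subseteq> edge_interval G e"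
      using s0(2)[OF e s] by blast
    have "(cmod (u e x))\<^sup>2 \<le> 2 / ((a + s) - a) * (\<integral>x. (cmod (u e x))\<^sup>2 \<partial>leb_on (edge_interval G e))
      + 2 * ((a + s) - a) * (\<integral>x. (cmod (weak_deriv (edge_interval G e) (u e) x))\<^sup>2 \<partial>leb_on (edge_interval G e))"
      using H1_graphD[OF u(1) e(1)] edge_interval_facts[OF e(1)] a s
      by (intro local_sup_bound) auto
    also have "\<dots> \<le> 2 / ((a + s) - a) * (m * m) + 2 * ((a + s) - a) * D\<^sup>2"
      using s edge_mass_le[OF e(1), of u] edge_kinetic_le[OF e(1), of u] u m
      by (intro add_mono mult_left_mono) auto
    also have "\<dots> = (2 / s\<^sub>0 + 2 * s\<^sub>0) * m * D"
      using s0(1) m u by (simp add: s_def field_simps power2_eq_square)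
    also have "\<dots> \<le> max 1 (2 / s\<^sub>0 + 2 * s\<^sub>0) * m * D"
      using m u by (intro mult_right_mono) auto
    finally show "(cmod (u e x))\<^sup>2 \<le> max 1 (2 / s\<^sub>0 + 2 * s\<^sub>0) * sqrt (mass G u) * D"
      by (simp add: m_def)
  qed simp
qed

lemma powr_integrable:
  assumes u: "u \<in> H1_graph G" and e: "e \<in> edges G" and p: "2 \<le> p" and M: "0 \<le> M"
    and bound: "\<And>x. x \<in> edge_interval G e \<Longrightarrow> cmod (u e x) \<le> M"
  shows "integrable (leb_on (edge_interval G e)) (\<lambda>x. cmod (u e x) powr p)"
    and "(\<integral>x. cmod (u e x) powr p \<partial>leb_on (edge_interval G e))
      \<le> M powr (p - 2) * (\<integral>x. (cmod (u e x))\<^sup>2 \<partial>leb_on (edge_interval G e))"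
proof -
  let ?M = "leb_on (edge_interval G e)"
  have I: "edge_interval G e \<in> sets borel" using edge_interval_facts[OF e] by simp
  have um: "u e \<in> borel_measurable ?M" and u2: "integrable ?M (\<lambda>x. (cmod (u e x))\<^sup>2)"
    using H1_graphD(2)[OF u e] I by (auto simp: L2_on_iff)
  have le: "cmod (u e x) powr p \<le> M powr (p - 2) * (cmod (u e x))\<^sup>2" if "x \<in> edge_interval G e" for x
  proof (cases "u e x = 0")
    case False
    have "cmod (u e x) powr p = cmod (u e x) powr ((p - 2) + 2)" by simp
    also have "\<dots> = cmod (u e x) powr (p - 2) * cmod (u e x) powr 2" by (rule powr_add)
    also have "\<dots> = cmod (u e x) powr (p - 2) * (cmod (u e x))\<^sup>2" using False by simp
    also have "\<dots> \<le> M powr (p - 2) * (cmod (u e x))\<^sup>2"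
      using p bound[OF that] by (intro mult_right_mono powr_mono2) auto
    finally show ?thesis .
  qed (use M in auto)
  then have AE: "AE x in ?M. cmod (u e x) powr p \<le> M powr (p - 2) * (cmod (u e x))\<^sup>2"
    using I by (simp add: AE_restrict_space_iff)
  have iM: "integrable ?M (\<lambda>x. M powr (p - 2) * (cmod (u e x))\<^sup>2)" using u2 by simp
  show int: "integrable ?M (\<lambda>x. cmod (u e x) powr p)"
    by (rule Bochner_Integration.integrable_bound[OF iM]) (use um AE in auto)
  show "(\<integral>x. cmod (u e x) powr p \<partial>?M) \<le> M powr (p - 2) * (\<integral>x. (cmod (u e x))\<^sup>2 \<partial>?M)"
    using integral_mono_AE[OF int iM AE] by simp
qed

lemma power_term_le:
  assumes u: "u \<in> H1_graph G" and p: "2 \<le> p" and M: "0 \<le> M"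
    and bound: "\<And>e x. e \<in> edges G \<Longrightarrow> x \<in> edge_interval G e \<Longrightarrow> cmod (u e x) \<le> M"
  shows "power_term G p u \<le> M powr (p - 2) * mass G u"
  unfolding power_term_def mass_def sum_distrib_left
  by (intro sum_mono powr_integrable u p M bound)

end

section \<open>Small masses and the potential on the core\<close>

lemma measurable_leb_on_continuous_on:
  fixes f :: "real \<Rightarrow> 'b::topological_space"
  assumes "continuous_on I f"
  shows "f \<in> borel_measurable (leb_on I)"
  using borel_measurable_continuous_on_restrict[OF assms]
  by (simp cong: measurable_cong_sets sets_restrict_space_cong)

lemma has_integral_exp_halfline:
  fixes c :: real
  assumes "0 < c"
  shows "integrable (leb_on {0..}) (\<lambda>x. exp (- c * x))" "(\<integral>x. exp (- c * x) \<partial>leb_on {0..}) = 1 / c"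
proof -
  have "(\<integral>\<^sup>+x. ennreal (exp (- c * x)) * indicator {0..} x \<partial>lborel) = ennreal (0 - (- exp (- c * 0) / c))"
  proof (rule nn_integral_FTC_atLeast)
    show "((\<lambda>x. - exp (- c * x) / c) has_real_derivative exp (- c * x)) (at x)" for x
      using assms by (auto intro!: derivative_eq_intros)
    have "((\<lambda>x. exp (- (c * x))) \<longlongrightarrow> 0) at_top"
      by (intro filterlim_compose[OF exp_at_bot] filterlim_uminus_at_bot_at_top[THEN filterlim_compose]
          filterlim_tendsto_pos_mult_at_top[OF tendsto_const assms filterlim_ident])
    from tendsto_divide[OF tendsto_minus[OF this] tendsto_const[of c]] assms
    show "((\<lambda>x. - exp (- c * x) / c) \<longlongrightarrow> 0) at_top" by simp
  qed auto
  moreover have "ennreal (indicator {0..} x *\<^sub>R exp (- c * x)) = ennreal (exp (- c * x)) * indicator {0..} x" for x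
    by (auto simp: indicator_def)
  ultimately have "(\<integral>\<^sup>+x. ennreal (indicator {0..} x *\<^sub>R exp (- c * x)) \<partial>lborel) = ennreal (1 / c)"
    by simp
  then have "has_bochner_integral lborel (\<lambda>x. indicator {0..} x *\<^sub>R exp (- c * x)) (1 / c)"
    by (intro has_bochner_integral_nn_integral) (use assms in auto)
  then show "integrable (leb_on {0..}) (\<lambda>x. exp (- c * x))" "(\<integral>x. exp (- c * x) \<partial>leb_on {0..}) = 1 / c"
    by (simp_all add: has_bochner_integral_iff integrable_restrict_space integral_restrict_space)
qed

lemma finite_measure_leb_on_Icc: "finite_measure (leb_on {a..b})"
  by (rule finite_measureI) (simp add: space_restrict_space emeasure_restrict_space emeasure_lborel_Icc_eq)

locale nls_graph = metric_graph G for G :: "('v, 'e) pre_metric_graph" +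
  fixes p :: real and w :: "'e \<Rightarrow> real \<Rightarrow> real"
  assumes p: "2 < p" "p < 6"
    and w_cont: "continuous_on_graph G w"
    and w_nonneg: "\<And>e x. e \<in> edges G \<Longrightarrow> x \<in> edge_interval G e \<Longrightarrow> 0 \<le> w e x"
    and w_nonzero: "\<exists>e\<in>edges G. \<exists>x\<in>edge_interval G e. w e x \<noteq> 0"
    and w_core: "supported_on_core G w"
begin

lemma bounded_edgeE:
  assumes "e \<in> bounded_edges G"
  obtains l where "0 < l" "edge_interval G e = {0..l}" "e \<in> edges G" "e \<notin> halflines G"
proof -
  have e: "e \<in> edges G" "e \<notin> halflines G" using assms by (auto simp: bounded_edges_def halflines_def)
  from e(1) show thesis by (cases rule: edge_cases) (use e that in auto)
qed

lemma w_cont_edge: "e \<in> edges G \<Longrightarrow> continuous_on (edge_interval G e) (w e)"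
  using w_cont by (simp add: continuous_on_graph_def)

lemma w_bounded:
  obtains W where "0 \<le> W" "\<And>e x. e \<in> bounded_edges G \<Longrightarrow> x \<in> edge_interval G e \<Longrightarrow> w e x \<le> W"
proof -
  have "\<exists>B. \<forall>x\<in>edge_interval G e. \<bar>w e x\<bar> \<le> B" if eb: "e \<in> bounded_edges G" for e
  proof -
    obtain l where e: "e \<in> edges G" and "edge_interval G e = {0..l}"
      using bounded_edgeE[OF eb] by metis
    then have "compact (w e ` edge_interval G e)"
      using w_cont_edge[OF e] by (intro compact_continuous_image) auto
    from compact_imp_bounded[OF this] show ?thesis unfolding bounded_iff by auto
  qed
  then obtain B where B: "\<And>e x. e \<in> bounded_edges G \<Longrightarrow> x \<in> edge_interval G e \<Longrightarrow> \<bar>w e x\<bar> \<le> B e"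
    by metis
  show thesis
  proof (rule that[of "\<Sum>e\<in>bounded_edges G. \<bar>B e\<bar>"])
    fix e x assume "e \<in> bounded_edges G" "x \<in> edge_interval G e"
    moreover from this have "\<bar>B e\<bar> \<le> (\<Sum>e\<in>bounded_edges G. \<bar>B e\<bar>)"
      by (intro member_le_sum) (use bounded_edges_subset in auto)
    ultimately show "w e x \<le> (\<Sum>e\<in>bounded_edges G. \<bar>B e\<bar>)" using B[of e x] by linarith
  qed (simp add: sum_nonneg)
qed

lemma potential_integrable:
  assumes u: "u \<in> H1_graph G" and e: "e \<in> bounded_edges G"
    and W: "\<And>x. x \<in> edge_interval G e \<Longrightarrow> w e x \<le> W"
  shows "integrable (leb_on (edge_interval G e)) (\<lambda>x. w e x * (cmod (u e x))\<^sup>2)"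
    and "(\<integral>x. w e x * (cmod (u e x))\<^sup>2 \<partial>leb_on (edge_interval G e))
      \<le> W * (\<integral>x. (cmod (u e x))\<^sup>2 \<partial>leb_on (edge_interval G e))"
proof -
  let ?M = "leb_on (edge_interval G e)"
  have e': "e \<in> edges G" using e bounded_edges_subset by blast
  have I: "edge_interval G e \<in> sets borel" using edge_interval_facts[OF e'] by simp
  have um: "u e \<in> borel_measurable ?M" and u2: "integrable ?M (\<lambda>x. (cmod (u e x))\<^sup>2)"
    using H1_graphD(2)[OF u e'] I by (auto simp: L2_on_iff)
  have wm: "w e \<in> borel_measurable ?M"
    by (rule measurable_leb_on_continuous_on[OF w_cont_edge[OF e']])
  have pt: "w e x * (cmod (u e x))\<^sup>2 \<le> W * (cmod (u e x))\<^sup>2"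
    "norm (w e x * (cmod (u e x))\<^sup>2) \<le> norm (W * (cmod (u e x))\<^sup>2)" if "x \<in> edge_interval G e" for x
  proof -
    show *: "w e x * (cmod (u e x))\<^sup>2 \<le> W * (cmod (u e x))\<^sup>2"
      by (intro mult_right_mono W that) simp
    have "0 \<le> w e x * (cmod (u e x))\<^sup>2" using w_nonneg[OF e' that] by simp
    then show "norm (w e x * (cmod (u e x))\<^sup>2) \<le> norm (W * (cmod (u e x))\<^sup>2)"
      using * unfolding real_norm_def by linarith
  qed
  have AE: "AE x in ?M. w e x * (cmod (u e x))\<^sup>2 \<le> W * (cmod (u e x))\<^sup>2"
    and AE': "AE x in ?M. norm (w e x * (cmod (u e x))\<^sup>2) \<le> norm (W * (cmod (u e x))\<^sup>2)"
    using I pt by (auto simp: AE_restrict_space_iff)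
  have iW: "integrable ?M (\<lambda>x. W * (cmod (u e x))\<^sup>2)" using u2 by simp
  show int: "integrable ?M (\<lambda>x. w e x * (cmod (u e x))\<^sup>2)"
    by (rule Bochner_Integration.integrable_bound[OF iW _ AE']) (use um wm in auto)
  show "(\<integral>x. w e x * (cmod (u e x))\<^sup>2 \<partial>?M) \<le> W * (\<integral>x. (cmod (u e x))\<^sup>2 \<partial>?M)"
    using integral_mono_AE[OF int iW AE] by simp
qed

lemma potential_le:
  assumes u: "u \<in> H1_graph G" and W: "0 \<le> W"
    "\<And>e x. e \<in> bounded_edges G \<Longrightarrow> x \<in> edge_interval G e \<Longrightarrow> w e x \<le> W"
  shows "potential G w u \<le> W * mass G u"
proof -
  have "potential G w u \<le> (\<Sum>e\<in>bounded_edges G. W * (\<integral>x. (cmod (u e x))\<^sup>2 \<partial>leb_on (edge_interval G e)))"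
    unfolding potential_def by (intro sum_mono potential_integrable u W)
  also have "\<dots> \<le> (\<Sum>e\<in>edges G. W * (\<integral>x. (cmod (u e x))\<^sup>2 \<partial>leb_on (edge_interval G e)))"
    by (rule sum_mono2) (use finite_edges bounded_edges_subset W in auto)
  finally show ?thesis by (simp add: mass_def sum_distrib_left)
qed

text \<open>
  On a halfline \<open>w\<close> vanishes, at the origin by continuity. So \<open>w\<close> is positive at some point of a
  bounded edge, and there its integral is positive.
\<close>

lemma core_potential_pos: "0 < (\<Sum>e\<in>bounded_edges G. \<integral>x. w e x \<partial>leb_on (edge_interval G e))"
proof -
  have "w e x = 0" if e: "e \<in> halflines G" "x \<in> edge_interval G e" for e x
  proof -
    have e': "e \<in> edges G" using e by (simp add: halflines_def)
    then have I: "edge_interval G e = {0..}"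
      using e(1) by (cases rule: edge_cases) (auto simp: bounded_edges_def halflines_def)
    have z: "w e y = 0" if "0 < y" for y
      using w_core e(1) that by (simp add: supported_on_core_def)
    show ?thesis
    proof (cases "x = 0")
      case True
      have "(\<lambda>n. w e (inverse (real (Suc n)))) \<longlonglongrightarrow> w e 0"
        by (rule continuous_on_tendsto_compose[OF w_cont_edge[OF e'] LIMSEQ_inverse_real_of_nat])
           (auto simp: I)
      then have "w e 0 = 0" using z by (simp add: LIMSEQ_const_iff)
      then show ?thesis using True by simp
    qed (use e(2) I z in auto)
  qed
  then obtain e x where ex: "e \<in> edges G" "e \<notin> halflines G" "x \<in> edge_interval G e" "w e x \<noteq> 0"
    using w_nonzero by blast
  have ce: "(\<integral>x. w e x \<partial>leb_on (edge_interval G e)) \<ge> 0" if "e \<in> bounded_edges G" for e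
  proof (rule Bochner_Integration.integral_nonneg_AE)
    have "e \<in> edges G" using that bounded_edges_subset by blast
    then show "AE x in leb_on (edge_interval G e). 0 \<le> w e x"
      using edge_interval_facts w_nonneg by (simp add: AE_restrict_space_iff)
  qed
  show ?thesis
    using ex(1)
  proof (cases rule: edge_cases)
    case (bounded l)
    have cont: "continuous_on {0..l} (w e)" using w_cont_edge[OF ex(1)] bounded by simp
    have "set_integrable lborel {0..l} (w e)"
      by (rule borel_integrable_atLeastAtMost') (rule cont)
    then have "(\<integral>x. w e x \<partial>leb_on (edge_interval G e)) = integral {0..l} (w e)"
      using set_borel_integral_eq_integral(2)[of "{0..l}" "w e"] bounded by (simp flip: set_lint_eq)
    moreover have "integral {0..l} (w e) \<noteq> 0"
      using integral_eq_0_iff[OF cont bounded(2)] w_nonneg[OF ex(1)] ex(3,4) bounded by auto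
    ultimately have "0 < (\<integral>x. w e x \<partial>leb_on (edge_interval G e))"
      using ce[OF bounded(1)] by simp
    then show ?thesis
      using bounded(1) bounded_edges_subset(2) ce by (intro sum_pos2[where i=e]) auto
  qed (use ex in simp)
qed

text \<open>
  The trial function is \<open>1\<close> on the core and \<open>exp (- \<epsilon> x)\<close> on each halfline. Its kinetic energy is
  of order \<open>\<epsilon>\<close>, while its potential term is the integral of \<open>w\<close>. After scaling to mass \<open>\<mu>\<close>
  the nonlinear term only helps, and the rest is proportional to \<open>\<mu>\<close>.
\<close>

lemma negative_level:
  obtains c where "0 < c" "\<And>\<mu>. 0 < \<mu> \<Longrightarrow> \<exists>v\<in>H1_mass G \<mu>. energy G p w v \<le> - c * \<mu>"
proof -
  define V where "V = (\<Sum>e\<in>bounded_edges G. \<integral>x. w e x \<partial>leb_on (edge_interval G e))"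
  have V: "0 < V" using core_potential_pos by (simp add: V_def)
  define N where "N = real (card (edges G))"
  have "bounded_edges G \<noteq> {}" using V by (auto simp: V_def)
  then obtain e\<^sub>0 where e0: "e\<^sub>0 \<in> bounded_edges G" "e\<^sub>0 \<in> edges G" using bounded_edges_subset by blast
  then have N: "0 < N" using finite_edges by (auto simp: N_def card_gt_0_iff)
  \<comment> \<open>each edge then contributes at most \<open>V / (2 N)\<close> to the kinetic term\<close>
  define \<epsilon> where "\<epsilon> = V / N"
  have \<epsilon>: "0 < \<epsilon>" using V N by (simp add: \<epsilon>_def)
  define \<phi> :: "'e \<Rightarrow> real \<Rightarrow> complex" where
    "\<phi> e x = of_real (if e \<in> halflines G then exp (- \<epsilon> * x) else 1)" for e x
  define \<phi>' :: "'e \<Rightarrow> real \<Rightarrow> complex" where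
    "\<phi>' e x = of_real (if e \<in> halflines G then - \<epsilon> * exp (- \<epsilon> * x) else 0)" for e x
  have d: "(\<phi> e has_vector_derivative \<phi>' e x) (at x)" for e x
  proof -
    have "((\<lambda>x. if e \<in> halflines G then exp (- \<epsilon> * x) else 1) has_real_derivative
        (if e \<in> halflines G then - \<epsilon> * exp (- \<epsilon> * x) else 0)) (at x)"
      by (cases "e \<in> halflines G") (auto intro!: derivative_eq_intros)
    then show ?thesis
      unfolding \<phi>_def[abs_def] \<phi>'_def
      by (rule has_vector_derivative_of_real)
  qed
  have c: "continuous_on A (\<phi> e)" "continuous_on A (\<phi>' e)" for A e
    unfolding \<phi>_def \<phi>'_def by (cases "e \<in> halflines G"; auto intro!: continuous_intros)+
  have edge: "L2_on (edge_interval G e) (\<phi> e) \<and> L2_on (edge_interval G e) (\<phi>' e) \<and>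
      (\<integral>x. (cmod (\<phi>' e x))\<^sup>2 \<partial>leb_on (edge_interval G e)) \<le> \<epsilon> / 2" if e: "e \<in> edges G" for e
    using e
  proof (cases rule: edge_cases)
    case (bounded l)
    then have h: "e \<notin> halflines G" by (auto simp: bounded_edges_def halflines_def)
    interpret finite_measure "leb_on {0..l}" by (rule finite_measure_leb_on_Icc)
    show ?thesis
      using h \<epsilon> c bounded(4) by (auto simp: L2_on_iff \<phi>_def \<phi>'_def intro: measurable_leb_on_continuous)
  next
    case halfline
    have eq: "(cmod (\<phi> e x))\<^sup>2 = exp (- (2 * \<epsilon>) * x)" "(cmod (\<phi>' e x))\<^sup>2 = \<epsilon>\<^sup>2 * exp (- (2 * \<epsilon>) * x)" for x
      using halfline by (simp_all add: \<phi>_def \<phi>'_def norm_mult power_mult_distrib flip: exp_of_nat_mult exp_of_real of_real_mult)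
    have pos: "0 < 2 * \<epsilon>" using \<epsilon> by simp
    have m: "\<phi> e \<in> borel_measurable (leb_on {0..})" "\<phi>' e \<in> borel_measurable (leb_on {0..})"
      by (rule measurable_leb_on_continuous; rule c)+
    show ?thesis
      unfolding halfline(2) using has_integral_exp_halfline[OF pos] m \<epsilon>
      by (simp add: L2_on_iff eq) (simp add: power2_eq_square)
  qed
  have wd: "H1_on (edge_interval G e) (\<phi> e)"
    "(\<integral>x. (cmod (weak_deriv (edge_interval G e) (\<phi> e) x))\<^sup>2 \<partial>leb_on (edge_interval G e)) \<le> \<epsilon> / 2"
    if e: "e \<in> edges G" for e
  proof -
    have "has_weak_derivative_on (edge_interval G e) (\<phi> e) (\<phi>' e)"
      by (rule weak_derivative_C1[OF edge_interval_facts(3)[OF e] d c(2)])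
    note * = integral_weak_deriv[OF edge_interval_facts(1,2)[OF e] c(1) _ _ this]
    show "H1_on (edge_interval G e) (\<phi> e)" using * edge[OF e] by blast
    show "(\<integral>x. (cmod (weak_deriv (edge_interval G e) (\<phi> e) x))\<^sup>2 \<partial>leb_on (edge_interval G e)) \<le> \<epsilon> / 2"
      using * edge[OF e] by simp
  qed
  have "continuous_on_graph G \<phi>"
    unfolding continuous_on_graph_def
  proof (intro conjI ballI c exI[of _ "\<lambda>_. 1"])
    show "\<phi> e 0 = 1" for e by (simp add: \<phi>_def)
    show "\<phi> e (real_of_ereal (len G e)) = 1" if "e \<in> bounded_edges G" for e
      using that by (auto simp: \<phi>_def bounded_edges_def halflines_def)
  qed
  then have H1: "\<phi> \<in> H1_graph G" using wd by (simp add: H1_graph_def)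
  have kin: "kinetic G \<phi> \<le> V / 2"
  proof -
    have "kinetic G \<phi> \<le> (\<Sum>e\<in>edges G. \<epsilon> / 2)"
      unfolding kinetic_def by (rule sum_mono) (rule wd(2))
    also have "\<dots> = V / 2" using N by (simp add: \<epsilon>_def N_def)
    finally show ?thesis .
  qed
  have pot: "potential G w \<phi> = V"
    unfolding potential_def V_def
    by (intro sum.cong refl Bochner_Integration.integral_cong)
       (auto simp: \<phi>_def bounded_edges_def halflines_def)
  have m: "0 < mass G \<phi>"
  proof -
    from e0(2) have "(\<integral>x. (cmod (\<phi> e\<^sub>0 x))\<^sup>2 \<partial>leb_on (edge_interval G e\<^sub>0)) > 0"
    proof (cases rule: edge_cases)
      case (bounded l)
      have "e\<^sub>0 \<notin> halflines G" using e0 by (auto simp: bounded_edges_def halflines_def)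
      then show ?thesis
        using bounded by (simp add: \<phi>_def measure_restrict_space)
    qed (use e0 in \<open>auto simp: bounded_edges_def halflines_def\<close>)
    then show ?thesis using edge_mass_le[OF e0(2), of \<phi>] by linarith
  qed
  show thesis
  proof (rule that[of "V / (4 * mass G \<phi>)"])
    show "0 < V / (4 * mass G \<phi>)" using V m by simp
    fix \<mu> :: real assume \<mu>: "0 < \<mu>"
    define r where "r = sqrt (\<mu> / mass G \<phi>)"
    have r2: "r\<^sup>2 = \<mu> / mass G \<phi>" using \<mu> m by (simp add: r_def)
    let ?v = "\<lambda>e x. of_real r * \<phi> e x"
    have "energy G p w ?v \<le> 1/2 * kinetic G ?v - 1/2 * potential G w ?v"
      using p(1) power_term_nonneg[of p ?v] by (simp add: energy_eq)
    also have "\<dots> = r\<^sup>2 * (1/2 * kinetic G \<phi> - 1/2 * V)"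
      by (simp add: scale_H1[OF H1] scale_terms pot algebra_simps)
    also have "\<dots> \<le> r\<^sup>2 * (- V / 4)"
      using kin by (intro mult_left_mono) auto
    also have "\<dots> = - (V / (4 * mass G \<phi>)) * \<mu>" using m by (simp add: r2 mult.commute)
    finally have "energy G p w ?v \<le> - (V / (4 * mass G \<phi>)) * \<mu>" .
    moreover have "?v \<in> H1_mass G \<mu>"
      using m scale_H1(1)[OF H1] by (simp add: H1_mass_iff scale_terms r2)
    ultimately show "\<exists>v\<in>H1_mass G \<mu>. energy G p w v \<le> - (V / (4 * mass G \<phi>)) * \<mu>" by blast
  qed
qed

text \<open>
  If \<open>E(u) \<le> 0\<close>, then \<open>\<parallel>u'\<parallel>\<^sup>2\<close> is bounded by the two negative terms. Suppose \<open>D = \<parallel>u'\<parallel> > 1\<close>. By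
  \<open>sup_bound\<close> the power term is at most a constant times \<open>\<mu> D^((p - 2)/2)\<close>, hence at most a
  constant times \<open>\<mu> D\<^sup>2\<close>, and the potential term is at most a constant times \<open>\<mu> \<le> \<mu> D\<^sup>2\<close>. For
  small \<open>\<mu>\<close> this is less than \<open>D\<^sup>2/2\<close>, a contradiction. Once \<open>D \<le> 1\<close>, \<open>sup_bound\<close> makes \<open>u\<close>
  uniformly small.
\<close>

lemma small_mass_bounds:
  assumes \<delta>: "0 < \<delta>"
  obtains \<mu>\<^sub>0 where "0 < \<mu>\<^sub>0"
    "\<And>\<mu> u. 0 < \<mu> \<Longrightarrow> \<mu> < \<mu>\<^sub>0 \<Longrightarrow> u \<in> H1_mass G \<mu> \<Longrightarrow> energy G p w u \<le> 0 \<Longrightarrow>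
      kinetic G u \<le> 1 \<and> (\<forall>e\<in>edges G. \<forall>x\<in>edge_interval G e. cmod (u e x) \<le> \<delta>)"
proof -
  obtain C where C: "1 \<le> C"
    "\<And>u D e x. u \<in> H1_graph G \<Longrightarrow> 0 < mass G u \<Longrightarrow> mass G u \<le> 1 \<Longrightarrow> 1 \<le> D \<Longrightarrow> kinetic G u \<le> D\<^sup>2 \<Longrightarrow>
      e \<in> edges G \<Longrightarrow> x \<in> edge_interval G e \<Longrightarrow> (cmod (u e x))\<^sup>2 \<le> C * sqrt (mass G u) * D"
    using sup_bound by blast
  obtain W where W: "0 \<le> W" "\<And>e x. e \<in> bounded_edges G \<Longrightarrow> x \<in> edge_interval G e \<Longrightarrow> w e x \<le> W"
    using w_bounded by blast
  define K where "K = sqrt C powr (p - 2)"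
  define B where "B = 2 * (K / p + W / 2)"
  have K: "0 < K" using C by (simp add: K_def)
  have B: "0 < B" using K p W by (simp add: B_def add_pos_nonneg)
  define \<mu>\<^sub>0 where "\<mu>\<^sub>0 = Min {1, 1 / B, (\<delta>\<^sup>2 / C)\<^sup>2}"
  have mu0: "0 < \<mu>\<^sub>0" "\<mu>\<^sub>0 \<le> 1" "\<mu>\<^sub>0 \<le> 1 / B" "\<mu>\<^sub>0 \<le> (\<delta>\<^sup>2 / C)\<^sup>2"
    using \<delta> B C by (auto simp: \<mu>\<^sub>0_def)
  have "kinetic G u \<le> 1 \<and> (\<forall>e\<in>edges G. \<forall>x\<in>edge_interval G e. cmod (u e x) \<le> \<delta>)"
    if \<mu>: "0 < \<mu>" "\<mu> < \<mu>\<^sub>0" and u: "u \<in> H1_mass G \<mu>" and E: "energy G p w u \<le> 0" for \<mu> u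
  proof -
    have u': "u \<in> H1_graph G" "mass G u = \<mu>" using u by (auto simp: H1_mass_iff)
    have kin: "kinetic G u \<le> 1"
    proof (rule ccontr)
      assume "\<not> kinetic G u \<le> 1"
      define D where "D = sqrt (kinetic G u)"
      have D: "1 < D" "kinetic G u = D\<^sup>2" using \<open>\<not> kinetic G u \<le> 1\<close> by (auto simp: D_def)
      have bd: "cmod (u e x) \<le> sqrt (C * D)" if "e \<in> edges G" "x \<in> edge_interval G e" for e x
      proof (rule real_le_rsqrt)
        have "(cmod (u e x))\<^sup>2 \<le> C * sqrt \<mu> * D"
          using C(2)[OF u'(1) _ _ _ _ that, of D] u'(2) D \<mu> mu0 by simp
        also have "\<dots> \<le> C * 1 * D"
          using C D \<mu> mu0 by (intro mult_right_mono mult_left_mono) auto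
        finally show "(cmod (u e x))\<^sup>2 \<le> C * D" by simp
      qed
      have "power_term G p u \<le> sqrt (C * D) powr (p - 2) * \<mu>"
        using power_term_le[OF u'(1) _ _ bd] p C D u'(2) by simp
      also have "\<dots> = K * (sqrt D powr (p - 2)) * \<mu>"
        using C D by (simp add: K_def real_sqrt_mult powr_mult)
      \<comment> \<open>\<open>p < 6\<close> and \<open>D > 1\<close> bound this power of \<open>D\<close> by \<open>D\<^sup>2\<close>\<close>
      also have "\<dots> \<le> K * D\<^sup>2 * \<mu>"
      proof -
        have "sqrt D powr (p - 2) \<le> sqrt D powr 4" using D p by (intro powr_mono) auto
        also have "\<dots> = D\<^sup>2" using D by (simp add: powr_half_sqrt[symmetric] powr_powr)
        finally show ?thesis using K \<mu> by (intro mult_right_mono mult_left_mono) auto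
      qed
      finally have P: "power_term G p u \<le> K * D\<^sup>2 * \<mu>" .
      have "potential G w u \<le> W * \<mu>" using potential_le[OF u'(1) W] u'(2) by simp
      also have "\<dots> \<le> W * (D\<^sup>2 * \<mu>)"
        using W(1) \<mu> D by (intro mult_left_mono) (auto simp: one_le_power)
      finally have V: "potential G w u \<le> W * (D\<^sup>2 * \<mu>)" .
      have "1/2 * D\<^sup>2 \<le> 1/p * power_term G p u + 1/2 * potential G w u"
        using E by (simp add: energy_eq D)
      also have "\<dots> \<le> 1/p * (K * D\<^sup>2 * \<mu>) + 1/2 * (W * (D\<^sup>2 * \<mu>))"
        using P V p by (intro add_mono mult_left_mono) auto
      also have "\<dots> = (B * \<mu>) * (1/2 * D\<^sup>2)" by (simp add: B_def algebra_simps)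
      also have "\<dots> < 1 * (1/2 * D\<^sup>2)"
      proof (rule mult_strict_right_mono)
        have "B * \<mu> < B * (1 / B)" using \<mu> mu0(3) B by (intro mult_strict_left_mono) auto
        then show "B * \<mu> < 1" using B by simp
      qed (use D in simp)
      finally show False by simp
    qed
    have "cmod (u e x) \<le> \<delta>" if "e \<in> edges G" "x \<in> edge_interval G e" for e x
    proof (rule power2_le_imp_le)
      have "(cmod (u e x))\<^sup>2 \<le> C * sqrt \<mu>"
        using C(2)[OF u'(1) _ _ _ _ that, of 1] u'(2) kin \<mu> mu0 by simp
      also have "\<dots> \<le> C * sqrt ((\<delta>\<^sup>2 / C)\<^sup>2)"
        using C \<mu> mu0 by (intro mult_left_mono real_sqrt_le_mono) auto
      also have "\<dots> = \<delta>\<^sup>2" using C by simp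
      finally show "(cmod (u e x))\<^sup>2 \<le> \<delta>\<^sup>2" .
    qed (use \<delta> in simp)
    with kin show ?thesis by blast
  qed
  with mu0(1) show thesis by (rule that) 
qed

end

section \<open>Compactness of minimizing sequences\<close>

context nls_graph
begin

lemma rational_in_edge:
  assumes e: "e \<in> edges G" and x: "x \<in> edge_interval G e" and r: "0 < r"
  obtains q where "q \<in> \<rat>" "q \<in> edge_interval G e" "\<bar>x - q\<bar> < r"
  using e
proof (cases rule: edge_cases)
  case (bounded l)
  have "max 0 (x - r) < min l (x + r)" using x r bounded by auto
  then obtain q where "q \<in> \<rat>" "max 0 (x - r) < q" "q < min l (x + r)"
    using Rats_dense_in_real by blast
  then show thesis using bounded by (intro that[of q]) auto
next
  case halfline
  obtain q where "q \<in> \<rat>" "x < q" "q < x + r"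
    using Rats_dense_in_real[of x "x + r"] r by auto
  then show thesis using halfline x by (intro that[of q]) auto
qed

text \<open>
  The integrand of \<open>c/2 \<parallel>u\<parallel>\<^sup>2 - 1/p \<parallel>u\<parallel>\<^sub>p\<^sup>p\<close>. The two terms are kept together because only
  their difference is nonnegative and thus accessible to Fatou's lemma.
\<close>

definition excess :: "real \<Rightarrow> ('e \<Rightarrow> real \<Rightarrow> complex) \<Rightarrow> 'e \<Rightarrow> real \<Rightarrow> real" where
  "excess c u e x = c / 2 * (cmod (u e x))\<^sup>2 - 1 / p * cmod (u e x) powr p"

lemma energy_plus_mass:
  assumes u: "u \<in> H1_graph G" and \<delta>: "0 \<le> \<delta>"
    and bound: "\<And>e x. e \<in> edges G \<Longrightarrow> x \<in> edge_interval G e \<Longrightarrow> cmod (u e x) \<le> \<delta>"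
  shows "e \<in> edges G \<Longrightarrow> integrable (leb_on (edge_interval G e)) (excess c u e)"
    and "energy G p w u + c / 2 * mass G u = 1 / 2 * kinetic G u
      + (\<Sum>e\<in>edges G. \<integral>x. excess c u e x \<partial>leb_on (edge_interval G e)) - 1 / 2 * potential G w u"
proof -
  have i1: "integrable (leb_on (edge_interval G e)) (\<lambda>x. c / 2 * (cmod (u e x))\<^sup>2)"
    and i2: "integrable (leb_on (edge_interval G e)) (\<lambda>x. 1 / p * cmod (u e x) powr p)"
    if e: "e \<in> edges G" for e
    using powr_integrable(1)[OF u e _ \<delta> bound[OF e]] p H1_graphD(2)[OF u e] edge_interval_facts(3)[OF e]
    by (auto simp: L2_on_iff)
  show "e \<in> edges G \<Longrightarrow> integrable (leb_on (edge_interval G e)) (excess c u e)"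
    using Bochner_Integration.integrable_diff[OF i1 i2] by (simp add: excess_def[abs_def])
  have "(\<Sum>e\<in>edges G. \<integral>x. excess c u e x \<partial>leb_on (edge_interval G e))
      = (\<Sum>e\<in>edges G. c / 2 * (\<integral>x. (cmod (u e x))\<^sup>2 \<partial>leb_on (edge_interval G e))
          - 1 / p * (\<integral>x. cmod (u e x) powr p \<partial>leb_on (edge_interval G e)))"
    by (rule sum.cong[OF refl])
       (simp add: excess_def Bochner_Integration.integral_diff[OF i1 i2] del: times_divide_eq_left)
  also have "\<dots> = c / 2 * mass G u - 1 / p * power_term G p u"
    by (simp add: sum_subtractf mass_def power_term_def flip: sum_distrib_left sum_divide_distrib)
  finally show "energy G p w u + c / 2 * mass G u = 1 / 2 * kinetic G u
      + (\<Sum>e\<in>edges G. \<integral>x. excess c u e x \<partial>leb_on (edge_interval G e)) - 1 / 2 * potential G w u"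
    by (simp add: energy_eq)
qed

text \<open>
  A subsequence converges at all rational points of all edges, and by the uniform Hoelder bound
  at every point. In the limit, Fatou's lemma handles the mass and the excess, lower semicontinuity
  handles the kinetic term, and dominated convergence on the bounded edges handles the potential.
\<close>

lemma compactness:
  fixes u :: "nat \<Rightarrow> 'e \<Rightarrow> real \<Rightarrow> complex"
  assumes u: "\<And>n. u n \<in> H1_mass G \<mu>" and kin: "\<And>n. kinetic G (u n) \<le> 1"
    and \<delta>: "0 \<le> \<delta>"
    and bound: "\<And>n e x. e \<in> edges G \<Longrightarrow> x \<in> edge_interval G e \<Longrightarrow> cmod (u n e x) \<le> \<delta>"
    and c: "0 \<le> c" "\<And>t. 0 \<le> t \<Longrightarrow> t \<le> \<delta> \<Longrightarrow> 1 / p * t powr p \<le> c / 2 * t\<^sup>2"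
    and en: "(\<lambda>n. energy G p w (u n)) \<longlonglongrightarrow> m"
  obtains v where "v \<in> H1_graph G"
    "\<And>e x. e \<in> edges G \<Longrightarrow> x \<in> edge_interval G e \<Longrightarrow> cmod (v e x) \<le> \<delta>"
    "mass G v \<le> \<mu>" "energy G p w v + c / 2 * mass G v \<le> m + c / 2 * \<mu>"
proof -
  let ?I = "edge_interval G"
  have uH: "u n \<in> H1_graph G" and um: "mass G (u n) = \<mu>" for n using u[of n] by (auto simp: H1_mass_iff)
  define kn where "kn n e = (\<integral>x. (cmod (weak_deriv (?I e) (u n e) x))\<^sup>2 \<partial>leb_on (?I e))" for n e
  define mn where "mn n e = (\<integral>x. (cmod (u n e x))\<^sup>2 \<partial>leb_on (?I e))" for n e
  define jn where "jn n e = (\<integral>x. excess c (u n) e x \<partial>leb_on (?I e))" for n e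
  have excess_nonneg: "0 \<le> excess c (u n) e x" if "e \<in> edges G" "x \<in> ?I e" for n e x
    using c(2)[OF norm_ge_zero bound[OF that]] by (simp add: excess_def)
  have kn: "0 \<le> kn n e" "kn n e \<le> 1" and mn: "0 \<le> mn n e" "mn n e \<le> \<mu>" and jn: "0 \<le> jn n e" "jn n e \<le> c / 2 * \<mu>"
    if e: "e \<in> edges G" for n e
  proof -
    show "0 \<le> kn n e" "0 \<le> mn n e" by (simp_all add: kn_def mn_def)
    show "kn n e \<le> 1" using edge_kinetic_le[OF e, of "u n"] kin[of n] by (simp add: kn_def)
    show mn: "mn n e \<le> \<mu>" using edge_mass_le[OF e, of "u n"] um[of n] by (simp add: mn_def)
    show "0 \<le> jn n e"
      unfolding jn_def
      by (rule Bochner_Integration.integral_nonneg_AE)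
         (use excess_nonneg[OF e] edge_interval_facts(3)[OF e] in \<open>simp add: AE_restrict_space_iff\<close>)
    have "jn n e \<le> (\<integral>x. c / 2 * (cmod (u n e x))\<^sup>2 \<partial>leb_on (?I e))"
      unfolding jn_def
    proof (rule integral_mono)
      show "integrable (leb_on (?I e)) (excess c (u n) e)"
        by (rule energy_plus_mass(1)[OF uH \<delta> bound e])
      show "integrable (leb_on (?I e)) (\<lambda>x. c / 2 * (cmod (u n e x))\<^sup>2)"
        using H1_graphD(2)[OF uH e] edge_interval_facts(3)[OF e] by (auto simp: L2_on_iff)
    qed (use p in \<open>simp add: excess_def\<close>)
    also have "\<dots> = c / 2 * mn n e" by (simp add: mn_def)
    also have "\<dots> \<le> c / 2 * \<mu>" using c(1) mn by (intro mult_left_mono) auto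
    finally show "jn n e \<le> c / 2 * \<mu>" .
  qed
  have \<mu>0: "0 \<le> \<mu>" using mass_nonneg[of "u 0"] um by simp
  \<comment> \<open>A single diagonal extraction must make both the point values and the three sequences of
    integrals on each edge converge, so all of them are packed into one family.\<close>
  define F :: "nat \<Rightarrow> ('e \<times> real) + ('e \<times> nat) \<Rightarrow> complex" where
    "F n i = (case i of Inl (e, x) \<Rightarrow> u n e x
      | Inr (e, k) \<Rightarrow> of_real (if k = 0 then kn n e else if k = 1 then mn n e else jn n e))" for n i
  define S where "S = Inl ` (SIGMA e:edges G. \<rat> \<inter> ?I e) \<union> Inr ` (edges G \<times> {0, 1, 2 :: nat})"
  have "countable S"
    unfolding S_def using finite_edges
    by (intro countable_Un countable_image countable_SIGMA countable_finite finite_SigmaI countable_Int1 countable_rat) auto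
  moreover have "norm (F n i) \<le> \<delta> + 1 + \<mu> + c / 2 * \<mu>" if "i \<in> S" for n i
  proof -
    have c\<mu>: "0 \<le> c / 2 * \<mu>" using c(1) \<mu>0 by simp
    show ?thesis
      using that
    proof (auto simp: S_def F_def)
      fix e x assume "e \<in> edges G" "x \<in> ?I e"
      from bound[OF this, of n] show "cmod (u n e x) \<le> \<delta> + 1 + \<mu> + c * \<mu> / 2" using c\<mu> \<mu>0 by simp
    next
      fix e assume e: "e \<in> edges G"
      show "\<bar>kn n e\<bar> \<le> \<delta> + 1 + \<mu> + c * \<mu> / 2" using kn[OF e, of n] c\<mu> \<mu>0 \<delta> by simp
      show "\<bar>mn n e\<bar> \<le> \<delta> + 1 + \<mu> + c * \<mu> / 2" using mn[OF e, of n] c\<mu> \<mu>0 \<delta> by simp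
      show "\<bar>jn n e\<bar> \<le> \<delta> + 1 + \<mu> + c * \<mu> / 2" using jn[OF e, of n] c\<mu> \<mu>0 \<delta> by simp
    qed
  qed
  ultimately obtain k where k: "strict_mono (k :: nat \<Rightarrow> nat)"
    and conv: "\<And>i. i \<in> S \<Longrightarrow> \<exists>l. (\<lambda>n. F (k n) i) \<longlonglongrightarrow> l"
    using function_convergent_subsequence[of S F "\<delta> + 1 + \<mu> + c / 2 * \<mu>"] by blast
  have convQ: "convergent (\<lambda>n. u (k n) e q)" if "e \<in> edges G" "q \<in> \<rat>" "q \<in> ?I e" for e q
    using conv[of "Inl (e, q)"] that by (auto simp: S_def F_def convergent_def)
  have scalar: "\<exists>l. (\<lambda>n. a (k n) e) \<longlonglongrightarrow> l"
    if e: "e \<in> edges G" and a: "\<And>n. F n (Inr (e, j)) = of_real (a n e)" and j: "j \<in> {0, 1, 2}" for e j and a :: "nat \<Rightarrow> 'e \<Rightarrow> real"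
  proof -
    obtain l where "(\<lambda>n. F (k n) (Inr (e, j))) \<longlonglongrightarrow> l"
      using conv[of "Inr (e, j)"] e j unfolding S_def by blast
    then have "(\<lambda>n. Re (of_real (a (k n) e))) \<longlonglongrightarrow> Re l"
      unfolding a by (rule tendsto_Re)
    then show ?thesis by auto
  qed
  have "\<forall>e\<in>edges G. \<exists>l. (\<lambda>n. kn (k n) e) \<longlonglongrightarrow> l" using scalar[of _ 0 kn] by (simp add: F_def)
  then obtain \<kappa> where \<kappa>: "\<And>e. e \<in> edges G \<Longrightarrow> (\<lambda>n. kn (k n) e) \<longlonglongrightarrow> \<kappa> e" by metis
  have "\<forall>e\<in>edges G. \<exists>l. (\<lambda>n. mn (k n) e) \<longlonglongrightarrow> l" using scalar[of _ 1 mn] by (simp add: F_def)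
  then obtain \<nu> where \<nu>: "\<And>e. e \<in> edges G \<Longrightarrow> (\<lambda>n. mn (k n) e) \<longlonglongrightarrow> \<nu> e" by metis
  have "\<forall>e\<in>edges G. \<exists>l. (\<lambda>n. jn (k n) e) \<longlonglongrightarrow> l" using scalar[of _ 2 jn] by (simp add: F_def)
  then obtain \<iota> where \<iota>: "\<And>e. e \<in> edges G \<Longrightarrow> (\<lambda>n. jn (k n) e) \<longlonglongrightarrow> \<iota> e" by metis
  have equi: "(cmod (u n e x - u n e y))\<^sup>2 \<le> \<bar>x - y\<bar>" if e: "e \<in> edges G" and xy: "x \<in> ?I e" "y \<in> ?I e" for n e x y
  proof -
    have *: "(cmod (u n e b - u n e a))\<^sup>2 \<le> b - a" if ab: "a \<le> b" "a \<in> ?I e" "b \<in> ?I e" for a b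
    proof -
      have sub: "{a..b} \<subseteq> ?I e"
        using ab edge_interval_facts(2)[OF e] unfolding is_interval_1 by fastforce
      have "(cmod (u n e b - u n e a))\<^sup>2 \<le> (b - a) * kn n e"
        unfolding kn_def
        by (rule weak_derivative_Hoelder) (use H1_graphD[OF uH e] edge_interval_facts[OF e] ab sub in auto)
      also have "\<dots> \<le> (b - a) * 1" using kn[OF e] ab by (intro mult_left_mono) auto
      finally show ?thesis by simp
    qed
    show ?thesis
      using *[of x y] *[of y x] xy by (cases "x \<le> y") (auto simp: norm_minus_commute)
  qed
  have cauchy: "convergent (\<lambda>n. u (k n) e x)" if e: "e \<in> edges G" and x: "x \<in> ?I e" for e x
  proof (rule Cauchy_convergent, rule metric_CauchyI)
    fix \<epsilon> :: real assume "0 < \<epsilon>"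
    then have pos: "0 < (\<epsilon> / 4)\<^sup>2" "0 < \<epsilon> / 4" by auto
    obtain q where q: "q \<in> \<rat>" "q \<in> ?I e" "\<bar>x - q\<bar> < (\<epsilon> / 4)\<^sup>2"
      using rational_in_edge[OF e x pos(1)] .
    have near: "cmod (u n e x - u n e q) < \<epsilon> / 4" for n
    proof (rule power_less_imp_less_base)
      show "(cmod (u n e x - u n e q))\<^sup>2 < (\<epsilon> / 4)\<^sup>2"
        by (rule le_less_trans[OF equi[OF e x q(2)] q(3)])
    qed (use pos(2) in simp)
    obtain N where N: "\<And>i j. N \<le> i \<Longrightarrow> N \<le> j \<Longrightarrow> dist (u (k i) e q) (u (k j) e q) < \<epsilon> / 4"
      using metric_CauchyD[OF convergent_Cauchy[OF convQ[OF e q(1,2)]] pos(2)] by blast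
    show "\<exists>N. \<forall>i\<ge>N. \<forall>j\<ge>N. dist (u (k i) e x) (u (k j) e x) < \<epsilon>"
    proof (intro exI[of _ N] allI impI)
      fix i j assume "N \<le> i" "N \<le> j"
      have "dist (u (k i) e x) (u (k j) e x) \<le> dist (u (k i) e x) (u (k i) e q)
          + dist (u (k i) e q) (u (k j) e q) + dist (u (k j) e q) (u (k j) e x)"
        using dist_triangle[of "u (k i) e x" "u (k j) e x" "u (k i) e q"]
          dist_triangle[of "u (k i) e q" "u (k j) e x" "u (k j) e q"] by linarith
      also have "\<dots> < \<epsilon> / 4 + \<epsilon> / 4 + \<epsilon> / 4"
        using near[of "k i"] near[of "k j"] N[OF \<open>N \<le> i\<close> \<open>N \<le> j\<close>]
        by (simp add: dist_norm norm_minus_commute)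
      also have "\<dots> < \<epsilon>" using \<open>0 < \<epsilon>\<close> by simp
      finally show "dist (u (k i) e x) (u (k j) e x) < \<epsilon>" .
    qed
  qed
  define v where "v e x = lim (\<lambda>n. u (k n) e x)" for e x
  have lim: "(\<lambda>n. u (k n) e x) \<longlonglongrightarrow> v e x" if "e \<in> edges G" "x \<in> ?I e" for e x
    using cauchy[OF that] by (simp add: v_def convergent_LIMSEQ_iff)
  have vb: "cmod (v e x) \<le> \<delta>" if "e \<in> edges G" "x \<in> ?I e" for e x
    by (rule LIMSEQ_le_const2[OF tendsto_norm[OF lim[OF that]]]) (use bound[OF that] in blast)
  have vc: "continuous_on (?I e) (v e)" if e: "e \<in> edges G" for e
    unfolding continuous_on_iff
  proof (intro ballI allI impI)
    fix x \<epsilon> assume x: "x \<in> ?I e" and "(0::real) < \<epsilon>"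
    show "\<exists>d>0. \<forall>x'\<in>?I e. dist x' x < d \<longrightarrow> dist (v e x') (v e x) < \<epsilon>"
    proof (intro exI[of _ "\<epsilon>\<^sup>2"] conjI ballI impI)
      fix y assume y: "y \<in> ?I e" "dist y x < \<epsilon>\<^sup>2"
      have "(\<lambda>n. (cmod (u (k n) e y - u (k n) e x))\<^sup>2) \<longlonglongrightarrow> (cmod (v e y - v e x))\<^sup>2"
        by (intro tendsto_intros lim e x y)
      then have "(cmod (v e y - v e x))\<^sup>2 \<le> \<bar>y - x\<bar>"
        by (rule LIMSEQ_le_const2) (use equi[OF e y(1) x] in blast)
      also have "\<bar>y - x\<bar> < \<epsilon>\<^sup>2" using y(2) by (simp add: dist_real_def)
      finally have "cmod (v e y - v e x) < \<epsilon>"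
        by (rule power_less_imp_less_base) (use \<open>0 < \<epsilon>\<close> in simp)
      then show "dist (v e y) (v e x) < \<epsilon>" by (simp add: dist_norm)
    qed (use \<open>0 < \<epsilon>\<close> in simp)
  qed
  have vg: "continuous_on_graph G v"
    unfolding continuous_on_graph_def
  proof (intro conjI ballI vc)
    have "\<forall>n. \<exists>a. (\<forall>e\<in>edges G. u n e 0 = a (origin G e)) \<and>
        (\<forall>e\<in>bounded_edges G. u n e (real_of_ereal (len G e)) = a (terminus G e))"
      using uH by (simp add: H1_graph_def continuous_on_graph_def)
    then obtain a where a: "\<And>n e. e \<in> edges G \<Longrightarrow> u n e 0 = a n (origin G e)"
      "\<And>n e. e \<in> bounded_edges G \<Longrightarrow> u n e (real_of_ereal (len G e)) = a n (terminus G e)"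
      by metis
    show "\<exists>a. (\<forall>e\<in>edges G. v e 0 = a (origin G e)) \<and>
        (\<forall>e\<in>bounded_edges G. v e (real_of_ereal (len G e)) = a (terminus G e))"
      by (intro exI[of _ "\<lambda>y. lim (\<lambda>n. a (k n) y)"]) (simp add: v_def a)
  qed
  have vm: "integrable (leb_on (?I e)) (\<lambda>x. (cmod (v e x))\<^sup>2) \<and> (\<integral>x. (cmod (v e x))\<^sup>2 \<partial>leb_on (?I e)) \<le> \<nu> e"
    if e: "e \<in> edges G" for e
  proof (rule fatou_bound[where h="\<lambda>n x. (cmod (u (k n) e x))\<^sup>2" and b="\<lambda>n. mn (k n) e"])
    show "integrable (leb_on (?I e)) (\<lambda>x. (cmod (u (k n) e x))\<^sup>2)" for n
      using H1_graphD(2)[OF uH e] edge_interval_facts(3)[OF e] by (auto simp: L2_on_iff)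
    show "AE x in leb_on (?I e). (\<lambda>n. (cmod (u (k n) e x))\<^sup>2) \<longlonglongrightarrow> (cmod (v e x))\<^sup>2"
      using lim[OF e] edge_interval_facts(3)[OF e]
      by (auto simp: AE_restrict_space_iff intro!: tendsto_intros)
    show "(\<lambda>x. (cmod (v e x))\<^sup>2) \<in> borel_measurable (leb_on (?I e))"
      by (intro measurable_leb_on_continuous_on continuous_intros vc e)
    show "(\<lambda>n. mn (k n) e) \<longlonglongrightarrow> \<nu> e" by (rule \<nu>[OF e])
  qed (auto simp: mn_def)
  have vL2: "L2_on (?I e) (v e)" if e: "e \<in> edges G" for e
    using vm[OF e] edge_interval_facts(3)[OF e] measurable_leb_on_continuous_on[OF vc[OF e]]
    by (simp add: L2_on_iff)
  have vd: "H1_on (?I e) (v e) \<and> (\<integral>x. (cmod (weak_deriv (?I e) (v e) x))\<^sup>2 \<partial>leb_on (?I e)) \<le> \<kappa> e"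
    if e: "e \<in> edges G" for e
  proof -
    note facts = edge_interval_facts[OF e]
    obtain g where g: "L2_on (?I e) g" "has_weak_derivative_on (?I e) (v e) g"
      "(\<integral>x. (cmod (g x))\<^sup>2 \<partial>leb_on (?I e)) \<le> \<kappa> e"
    proof (rule weak_derivative_lower_semicontinuous[of "?I e" "\<lambda>n. u (k n) e"
          "\<lambda>n. weak_deriv (?I e) (u (k n) e)" "v e" \<delta> "\<lambda>n. kn (k n) e" "\<kappa> e"])
      show "(\<lambda>n. kn (k n) e) \<longlonglongrightarrow> \<kappa> e" by (rule \<kappa>[OF e])
      show "(\<integral>x. (cmod (weak_deriv (?I e) (u (k n) e) x))\<^sup>2 \<partial>leb_on (?I e)) \<le> kn (k n) e" for n
        by (simp add: kn_def)
    qed (use facts H1_graphD[OF uH e] vL2[OF e] lim[OF e] bound[OF e] in auto)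
    note wd = integral_weak_deriv[OF facts(1,2) vc[OF e] vL2[OF e] g(1,2)]
    show ?thesis using wd g(3) by simp
  qed
  have vH: "v \<in> H1_graph G" using vg vd by (simp add: H1_graph_def)
  have vj: "(\<integral>x. excess c v e x \<partial>leb_on (?I e)) \<le> \<iota> e" if e: "e \<in> edges G" for e
  proof (rule conjunct2[OF fatou_bound[where h="\<lambda>n. excess c (u (k n)) e" and b="\<lambda>n. jn (k n) e"]])
    show "integrable (leb_on (?I e)) (excess c (u (k n)) e)" for n
      by (rule energy_plus_mass(1)[OF uH \<delta> bound e])
    show "AE x in leb_on (?I e). 0 \<le> excess c (u (k n)) e x" for n
      using excess_nonneg[OF e] edge_interval_facts(3)[OF e] by (simp add: AE_restrict_space_iff)
    have "(\<lambda>n. excess c (u (k n)) e x) \<longlonglongrightarrow> excess c v e x" if "x \<in> ?I e" for x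
      unfolding excess_def
      by (intro tendsto_intros lim e that tendsto_powr') (use p in auto)
    then show "AE x in leb_on (?I e). (\<lambda>n. excess c (u (k n)) e x) \<longlonglongrightarrow> excess c v e x"
      using edge_interval_facts(3)[OF e] by (simp add: AE_restrict_space_iff)
    show "excess c v e \<in> borel_measurable (leb_on (?I e))"
      using energy_plus_mass(1)[OF vH \<delta> vb e] by blast
    show "(\<lambda>n. jn (k n) e) \<longlonglongrightarrow> \<iota> e" by (rule \<iota>[OF e])
  qed (auto simp: jn_def)
  have pot: "(\<lambda>n. potential G w (u (k n))) \<longlonglongrightarrow> potential G w v"
    unfolding potential_def
  proof (rule tendsto_sum)
    fix e assume eb: "e \<in> bounded_edges G"
    then obtain l where l: "0 < l" "?I e = {0..l}" and e: "e \<in> edges G" using bounded_edgeE by metis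
    obtain W where W: "0 \<le> W" "\<And>e x. e \<in> bounded_edges G \<Longrightarrow> x \<in> ?I e \<Longrightarrow> w e x \<le> W"
      using w_bounded by blast
    show "(\<lambda>n. \<integral>x. w e x * (cmod (u (k n) e x))\<^sup>2 \<partial>leb_on (?I e)) \<longlonglongrightarrow> (\<integral>x. w e x * (cmod (v e x))\<^sup>2 \<partial>leb_on (?I e))"
    proof (rule integral_dominated_convergence[where w="\<lambda>_. W * \<delta>\<^sup>2"])
      show "integrable (leb_on (?I e)) (\<lambda>_. W * \<delta>\<^sup>2)"
        unfolding l by (rule finite_measure.integrable_const[OF finite_measure_leb_on_Icc])
      show "(\<lambda>x. w e x * (cmod (u (k n) e x))\<^sup>2) \<in> borel_measurable (leb_on (?I e))" for n
        using potential_integrable(1)[OF uH eb W(2)[OF eb]] by blast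
      show "(\<lambda>x. w e x * (cmod (v e x))\<^sup>2) \<in> borel_measurable (leb_on (?I e))"
        using potential_integrable(1)[OF vH eb W(2)[OF eb]] by blast
      show "AE x in leb_on (?I e). (\<lambda>n. w e x * (cmod (u (k n) e x))\<^sup>2) \<longlonglongrightarrow> w e x * (cmod (v e x))\<^sup>2"
        using lim[OF e] edge_interval_facts(3)[OF e]
        by (auto simp: AE_restrict_space_iff intro!: tendsto_intros)
      have "norm (w e x * (cmod (u (k n) e x))\<^sup>2) \<le> W * \<delta>\<^sup>2" if "x \<in> ?I e" for n x
      proof -
        have "w e x * (cmod (u (k n) e x))\<^sup>2 \<le> W * \<delta>\<^sup>2"
          using W(2)[OF eb that] w_nonneg[OF e that] bound[OF e that] by (intro mult_mono power_mono) auto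
        moreover have "0 \<le> w e x * (cmod (u (k n) e x))\<^sup>2" using w_nonneg[OF e that] by simp
        ultimately show ?thesis by simp
      qed
      then show "AE x in leb_on (?I e). norm (w e x * (cmod (u (k n) e x))\<^sup>2) \<le> W * \<delta>\<^sup>2" for n
        using edge_interval_facts(3)[OF e] by (simp add: AE_restrict_space_iff)
    qed
  qed
  have "mass G v \<le> \<mu>"
  proof -
    have "(\<lambda>n. \<Sum>e\<in>edges G. mn (k n) e) \<longlonglongrightarrow> (\<Sum>e\<in>edges G. \<nu> e)"
      by (intro tendsto_sum \<nu>)
    moreover have "(\<Sum>e\<in>edges G. mn (k n) e) = \<mu>" for n
      using um[of "k n"] by (simp add: mass_def mn_def)
    ultimately have "(\<Sum>e\<in>edges G. \<nu> e) = \<mu>" by (simp add: LIMSEQ_const_iff)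
    moreover have "mass G v \<le> (\<Sum>e\<in>edges G. \<nu> e)"
      unfolding mass_def by (rule sum_mono) (use vm in blast)
    ultimately show ?thesis by simp
  qed
  moreover have "energy G p w v + c / 2 * mass G v \<le> m + c / 2 * \<mu>"
  proof -
    have lim1: "(\<lambda>n. energy G p w (u (k n)) + c / 2 * mass G (u (k n))) \<longlonglongrightarrow> m + c / 2 * \<mu>"
      unfolding um by (intro tendsto_intros LIMSEQ_subseq_LIMSEQ[OF en k, unfolded o_def])
    have eq: "energy G p w (u (k n)) + c / 2 * mass G (u (k n))
        = 1 / 2 * (\<Sum>e\<in>edges G. kn (k n) e) + (\<Sum>e\<in>edges G. jn (k n) e) - 1 / 2 * potential G w (u (k n))" for n
      using energy_plus_mass(2)[OF uH \<delta> bound, of "k n" c] by (simp add: kinetic_def kn_def jn_def)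
    have lim2: "(\<lambda>n. 1 / 2 * (\<Sum>e\<in>edges G. kn (k n) e) + (\<Sum>e\<in>edges G. jn (k n) e) - 1 / 2 * potential G w (u (k n)))
        \<longlonglongrightarrow> 1 / 2 * (\<Sum>e\<in>edges G. \<kappa> e) + (\<Sum>e\<in>edges G. \<iota> e) - 1 / 2 * potential G w v"
      by (intro tendsto_intros \<kappa> \<iota> pot)
    have "m + c / 2 * \<mu> = 1 / 2 * (\<Sum>e\<in>edges G. \<kappa> e) + (\<Sum>e\<in>edges G. \<iota> e) - 1 / 2 * potential G w v"
      using lim1 unfolding eq by (rule LIMSEQ_unique[OF _ lim2])
    moreover have "kinetic G v \<le> (\<Sum>e\<in>edges G. \<kappa> e)"
      unfolding kinetic_def by (rule sum_mono) (use vd in blast)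
    moreover have "(\<Sum>e\<in>edges G. \<integral>x. excess c v e x \<partial>leb_on (?I e)) \<le> (\<Sum>e\<in>edges G. \<iota> e)"
      by (rule sum_mono) (rule vj)
    ultimately show ?thesis
      using energy_plus_mass(2)[OF vH \<delta> vb, of c] by linarith
  qed
  ultimately show thesis using that[OF vH] vb by blast
qed

text \<open>
  The threshold \<open>\<delta>\<close> is the value of \<open>t\<close> at which \<open>1/p t\<^sup>p = c/2 t\<^sup>2\<close>; \<open>c\<close> is the constant of
  \<open>negative_level\<close>, and its half in the excess leaves the strict gap \<open>- m > c/2 \<mu>\<close>.
\<close>

lemma ground_state_exists:
  "\<exists>\<mu>\<^sub>0>0. \<forall>\<mu>. 0 < \<mu> \<and> \<mu> < \<mu>\<^sub>0 \<longrightarrow> (\<exists>u. ground_state G p w \<mu> u)"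
proof -
  obtain c where c: "0 < c" "\<And>\<mu>. 0 < \<mu> \<Longrightarrow> \<exists>v\<in>H1_mass G \<mu>. energy G p w v \<le> - c * \<mu>"
    using negative_level by blast
  define \<delta> where "\<delta> = (c * p / 2) powr (1 / (p - 2))"
  have \<delta>: "0 < \<delta>" using c p by (simp add: \<delta>_def)
  have dom: "1 / p * t powr p \<le> c / 2 * t\<^sup>2" if t: "0 \<le> t" "t \<le> \<delta>" for t
  proof (cases "t = 0")
    case False
    have "t powr (p - 2) \<le> \<delta> powr (p - 2)" using t p by (intro powr_mono2) auto
    also have "\<dots> = c * p / 2" using p c by (simp add: \<delta>_def powr_powr)
    finally have le: "t powr (p - 2) \<le> c * p / 2" .
    have "t powr p = t powr ((p - 2) + 2)" by simp
    also have "\<dots> = t powr (p - 2) * t powr 2" by (rule powr_add)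
    also have "\<dots> = t powr (p - 2) * t\<^sup>2" using t False by simp
    also have "\<dots> \<le> (c * p / 2) * t\<^sup>2" using le by (intro mult_right_mono) auto
    finally show ?thesis using p by (simp add: field_simps)
  qed simp
  obtain \<mu>\<^sub>0 where \<mu>0: "0 < \<mu>\<^sub>0"
    "\<And>\<mu> u. 0 < \<mu> \<Longrightarrow> \<mu> < \<mu>\<^sub>0 \<Longrightarrow> u \<in> H1_mass G \<mu> \<Longrightarrow> energy G p w u \<le> 0 \<Longrightarrow>
      kinetic G u \<le> 1 \<and> (\<forall>e\<in>edges G. \<forall>x\<in>edge_interval G e. cmod (u e x) \<le> \<delta>)"
    using small_mass_bounds[OF \<delta>] by blast
  have "\<exists>u. ground_state G p w \<mu> u" if \<mu>: "0 < \<mu>" "\<mu> < \<mu>\<^sub>0" for \<mu>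
  proof -
    obtain W where W: "0 \<le> W" "\<And>e x. e \<in> bounded_edges G \<Longrightarrow> x \<in> edge_interval G e \<Longrightarrow> w e x \<le> W"
      using w_bounded by blast
    define B where "B = 1 / p * (\<delta> powr (p - 2) * \<mu>) + 1 / 2 * (W * \<mu>)"
    have "0 \<le> B" using p W \<mu> by (simp add: B_def)
    have lower: "- B \<le> energy G p w u" if u: "u \<in> H1_mass G \<mu>" for u
    proof (cases "energy G p w u \<le> 0")
      case True
      have u': "u \<in> H1_graph G" "mass G u = \<mu>" using u by (auto simp: H1_mass_iff)
      have "power_term G p u \<le> \<delta> powr (p - 2) * \<mu>"
        using power_term_le[OF u'(1), of p \<delta>] \<mu>0(2)[OF \<mu> u True] p \<delta> u' by auto
      then have "1 / p * power_term G p u \<le> 1 / p * (\<delta> powr (p - 2) * \<mu>)"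
        using p by (intro mult_left_mono) auto
      moreover have "potential G w u \<le> W * \<mu>" using potential_le[OF u'(1) W] u' by simp
      ultimately show ?thesis using kinetic_nonneg[of u] unfolding energy_eq B_def by linarith
    qed (use \<open>0 \<le> B\<close> in linarith)
    define m where "m = Inf (energy G p w ` H1_mass G \<mu>)"
    have bdd: "bdd_below (energy G p w ` H1_mass G \<mu>)"
      by (rule bdd_belowI[of _ "- B"]) (use lower in auto)
    have m_le: "m \<le> energy G p w u" if "u \<in> H1_mass G \<mu>" for u
      unfolding m_def by (rule cInf_lower[OF _ bdd]) (use that in simp)
    obtain v\<^sub>0 where v0: "v\<^sub>0 \<in> H1_mass G \<mu>" "energy G p w v\<^sub>0 \<le> - c * \<mu>" using c(2)[OF \<mu>(1)] by blast
    have m_neg: "m \<le> - c * \<mu>" using m_le[OF v0(1)] v0(2) by linarith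
    have c\<mu>: "0 < c * \<mu>" using c \<mu> by simp
    have "\<exists>u. u \<in> H1_mass G \<mu> \<and> energy G p w u < min 0 (m + 1 / real (Suc n))" for n
    proof -
      have "m < min 0 (m + 1 / real (Suc n))" using m_neg c\<mu> by simp
      then show ?thesis
        using cInf_lessD[of "energy G p w ` H1_mass G \<mu>"] v0(1) unfolding m_def by blast
    qed
    then obtain u where u: "\<And>n. u n \<in> H1_mass G \<mu>"
      and un: "\<And>n. energy G p w (u n) < min 0 (m + 1 / real (Suc n))" by metis
    have bounds: "kinetic G (u n) \<le> 1" "e \<in> edges G \<Longrightarrow> x \<in> edge_interval G e \<Longrightarrow> cmod (u n e x) \<le> \<delta>" for n e x
      using \<mu>0(2)[OF \<mu> u[of n]] un[of n] by auto
    have en: "(\<lambda>n. energy G p w (u n)) \<longlonglongrightarrow> m"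
    proof (rule tendsto_sandwich[of "\<lambda>_. m" _ _ "\<lambda>n. m + 1 / real (Suc n)"])
      show "(\<lambda>n. m + 1 / real (Suc n)) \<longlonglongrightarrow> m"
        using tendsto_add[OF tendsto_const LIMSEQ_inverse_real_of_nat, of m] by (simp add: inverse_eq_divide)
      show "\<forall>\<^sub>F n in sequentially. energy G p w (u n) \<le> m + 1 / real (Suc n)"
        using un by (auto intro!: always_eventually less_imp_le)
    qed (use m_le[OF u] in auto)
    obtain v where v: "v \<in> H1_graph G" "mass G v \<le> \<mu>"
      and vb: "\<And>e x. e \<in> edges G \<Longrightarrow> x \<in> edge_interval G e \<Longrightarrow> cmod (v e x) \<le> \<delta>"
      and E: "energy G p w v + c / 2 * mass G v \<le> m + c / 2 * \<mu>"
    proof (rule compactness[of u \<mu> \<delta> c m])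
      show "u n \<in> H1_mass G \<mu>" "kinetic G (u n) \<le> 1" for n by (rule u, rule bounds)
      show "e \<in> edges G \<Longrightarrow> x \<in> edge_interval G e \<Longrightarrow> cmod (u n e x) \<le> \<delta>" for n e x by (rule bounds)
      show "0 \<le> t \<Longrightarrow> t \<le> \<delta> \<Longrightarrow> 1 / p * t powr p \<le> c / 2 * t\<^sup>2" for t by (rule dom)
      show "(\<lambda>n. energy G p w (u n)) \<longlonglongrightarrow> m" by (rule en)
      fix v assume v: "v \<in> H1_graph G" "mass G v \<le> \<mu>"
        "energy G p w v + c / 2 * mass G v \<le> m + c / 2 * \<mu>"
        and vb: "\<And>e x. e \<in> edges G \<Longrightarrow> x \<in> edge_interval G e \<Longrightarrow> cmod (v e x) \<le> \<delta>"
      show thesis by (rule that[OF v(1,2) vb v(3)])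
    qed (use \<delta> c in auto)
    define a where "a = mass G v"
    have a: "0 \<le> a" "a \<le> \<mu>" using mass_nonneg v(2) by (auto simp: a_def)
    have "a = \<mu>"
    proof (rule ccontr)
      assume "a \<noteq> \<mu>"
      with a have lt: "a < \<mu>" by simp
      \<comment> \<open>for \<open>a > 0\<close> this is \<open>m \<le> (\<mu>/a) E(v)\<close>; the product form also covers \<open>a = 0\<close>\<close>
      have "m * a \<le> \<mu> * energy G p w v"
      proof (cases "a = 0")
        case True
        have "0 \<le> energy G p w v"
        proof -
          have "power_term G p v \<le> 0" "potential G w v \<le> 0"
            using power_term_le[OF v(1), of p \<delta>] vb potential_le[OF v(1) W] p \<delta> True
            by (simp_all add: a_def)
          then have "1 / p * power_term G p v \<le> 0" using p by (simp add: divide_nonpos_pos)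
          then show ?thesis
            using kinetic_nonneg[of v] \<open>potential G w v \<le> 0\<close> unfolding energy_eq by linarith
        qed
        then show ?thesis using True \<mu> by simp
      next
        case False
        with a have "0 < a" by simp
        define r where "r = sqrt (\<mu> / a)"
        have r2: "r\<^sup>2 = \<mu> / a" using \<mu> \<open>0 < a\<close> by (simp add: r_def)
        have r1: "1 \<le> r" using \<open>0 < a\<close> lt by (simp add: r_def)
        have "(\<lambda>e x. of_real r * v e x) \<in> H1_mass G \<mu>"
          using \<open>0 < a\<close> scale_H1(1)[OF v(1)] by (simp add: H1_mass_iff scale_terms r2 flip: a_def)
        then have "m \<le> energy G p w (\<lambda>e x. of_real r * v e x)" by (rule m_le)
        also have "\<dots> \<le> r\<^sup>2 * energy G p w v"
          using energy_scale_le[OF v(1) r1] p by simp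
        finally show ?thesis using \<open>0 < a\<close> by (simp add: r2 field_simps)
      qed
      also have "\<mu> * energy G p w v \<le> \<mu> * (m + c / 2 * \<mu> - c / 2 * a)"
        using E \<mu> by (intro mult_left_mono) (auto simp: a_def)
      finally have "m * a - \<mu> * (m + c / 2 * \<mu> - c / 2 * a) \<le> 0" by simp
      moreover have "m * a - \<mu> * (m + c / 2 * \<mu> - c / 2 * a) = (- m - c / 2 * \<mu>) * (\<mu> - a)"
        by (simp add: field_simps)
      moreover have "0 < (- m - c / 2 * \<mu>) * (\<mu> - a)"
        using m_neg c\<mu> lt by (intro mult_pos_pos) auto
      ultimately show False by linarith
    qed
    then have vmass: "v \<in> H1_mass G \<mu>" and Ev: "energy G p w v \<le> m"
      using v(1) E by (auto simp: H1_mass_iff a_def)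
    have "ground_state G p w \<mu> v"
      unfolding ground_state_def
    proof (intro conjI vmass antisym)
      show "ereal (energy G p w v) \<le> (INF v\<in>H1_mass G \<mu>. ereal (energy G p w v))"
        by (rule INF_greatest) (use Ev m_le in force)
      show "(INF v\<in>H1_mass G \<mu>. ereal (energy G p w v)) \<le> ereal (energy G p w v)"
        by (rule INF_lower[OF vmass])
    qed
    then show ?thesis by blast
  qed
  with \<mu>0(1) show ?thesis by blast
qed

end

theorem theorem4p2:
  fixes G :: "('v, 'e) pre_metric_graph"
    and p :: real
    and w :: "'e \<Rightarrow> real \<Rightarrow> real"
  assumes "2 < p" and "p < 6"
    and "metric_graph G"
    and "card (halflines G) \<ge> 1"
    and "continuous_on_graph G w"
    and "\<forall>e\<in>edges G. \<forall>x\<in>edge_interval G e. 0 \<le> w e x"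
    and "\<exists>e\<in>edges G. \<exists>x\<in>edge_interval G e. w e x \<noteq> 0"
    and "supported_on_core G w"
  shows "\<exists>\<mu>\<^sub>0>0. \<forall>\<mu>. 0 < \<mu> \<and> \<mu> < \<mu>\<^sub>0 \<longrightarrow> (\<exists>u. ground_state G p w \<mu> u)"
proof -
  interpret metric_graph G by (rule assms(3))
  interpret nls_graph G p w
    by unfold_locales (use assms in auto)
  show ?thesis by (rule ground_state_exists)
qed

end
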